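(* For all integers $a,b\geq 2$ and all $n\geq 0$, the sets $\mathcal{D}(a,b)\cap\mathrm{DP}_n$ and $\mathcal{D}(b,a)\cap\mathrm{DP}_n$ are $n$-opposite to each other.
   Context: Partitions are identified up to trailing zeros; $\ell(\gamma)$ is the number of nonzero parts, $|\gamma|$ the sum of parts; the diagram of $\gamma$ is $\{(i,j):1\leq i\leq\ell(\gamma),1\leq j\leq\gamma_i\}$. For a cell $c=(i,j)$, $\mathrm{arm}(c)=\gamma_i-j$, $\mathrm{leg}(c)=\gamma'_j-i$ ($\gamma'$ the conjugate). $\mathrm{dinv}(\gamma)$ is the number of cells with $\mathrm{arm}(c)-\mathrm{leg}(c)\in\{0,1\}$. $\gamma\in\mathrm{DP}_n$ means the diagram of $\gamma$ is contained in that of $(n-1,n-2,\ldots,1,0)$; then $\mathrm{area}_n(\gamma)=\binom{n}{2}-|\gamma|$. Subsets $B,C\subseteq\mathrm{DP}_n$ are $n$-opposite if there is a unique bijection $g:B\to C$ with $\mathrm{area}_n(\gamma)=\mathrm{dinv}(g(\gamma))$ and $\mathrm{dinv}(\gamma)=\mathrm{area}_n(g(\gamma))$ for all $\gamma\in B$. If $\gamma_1\leq\ell(\gamma)+2$, $\nu(\gamma)=(\ell(\gamma)+1,\gamma_1-1,\ldots,\gamma_{\ell(\gamma)}-1)$; $\nu^m$ is the $m$-fold iterate. For integers $j$ and $\ell>0$, $r_{j,\ell}=j-\ell\lfloor j/\ell\rfloor$. For $k\geq0,\ell>0$, $\mathbb{I}_{k,\ell}=(\underline{\ell}^{1+\lfloor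 k/\ell\rfloor},\ell-1,\ldots,1)+(\underline{0}^{1+\lfloor k/\ell\rfloor},\underline{1}^{r_{k,\ell}},\underline{0}^{\ell-1-r_{k,\ell}})$, where $\underline{c}^d$ is $d$ copies of $c$ and sequences are added entrywise after padding with zeros. Totally order cells of $\mathbb{Z}_{>0}^2$ by $(i,j)<(i',j')$ iff $i+j<i'+j'$, or $i+j=i'+j'$ and $i<i'$; for a partition $\gamma$, $u_q(\gamma)$ is the $q$-th largest cell of its diagram in this order, and $\gamma\setminus\{u_q\}$ is the partition whose diagram is that of $\gamma$ with this cell removed. For integers $p,q\geq2$ define $\gamma_i$ ($i\geq1$) by $\gamma_i=\mathbb{I}_{(q-1)p,i}+\mathbb{I}_{p-2,1}$ for $1\leq i\leq q-1$ and $\gamma_i=\mathbb{I}_{q(p-1),i+1}\setminus\{u_q\}$ for $i\geq q$; set $R_i=\{\nu^m(\gamma_i):0\leq m\leq i\}$ for $1\leq i\leq q-2$ and $R_i=\{\nu^m(\gamma_i):0\leq m\leq i+1\}$ for $i\geq q-1$; and $\mathcal{D}(p,q)=\bigcup_{i\geq1}R_i$. (In the paper, $\mathcal{D}(a,b)=\mathcal{C}_{(ab-b-1,b-1)}$ and $\mathcal{D}(b,a)=\mathcal{C}_{(ab-a-1,a-1)}$.) *)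

theory Defs
  imports Main "HOL-Library.FuncSet"
begin

text \<open>
  Partitions up to trailing zeros are represented by their canonical representatives: weakly
  decreasing lists of positive parts. Parts, rows and columns are numbered from 1.
\<close>

definition is_partition :: "nat list \<Rightarrow> bool" where
  "is_partition \<gamma> \<longleftrightarrow> sorted_wrt (\<ge>) \<gamma> \<and> 0 \<notin> set \<gamma>"

definition part :: "nat list \<Rightarrow> nat \<Rightarrow> nat" where
  "part \<gamma> i = (if 1 \<le> i \<and> i \<le> length \<gamma> then \<gamma> ! (i - 1) else 0)"

text \<open>On a weakly decreasing list this removes exactly the trailing zeros.\<close>

definition strip :: "nat list \<Rightarrow> nat list" where
  "strip \<gamma> = filter (\<lambda>x. x \<noteq> 0) \<gamma>"

definition plen :: "nat list \<Rightarrow> nat" where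
  "plen \<gamma> = length (strip \<gamma>)"

definition psize :: "nat list \<Rightarrow> nat" where
  "psize \<gamma> = sum_list \<gamma>"

definition padd :: "nat list \<Rightarrow> nat list \<Rightarrow> nat list" where
  "padd \<alpha> \<beta> = map (\<lambda>i. part \<alpha> i + part \<beta> i) [1..<Suc (max (length \<alpha>) (length \<beta>))]"

definition diagram :: "nat list \<Rightarrow> (nat \<times> nat) set" where
  "diagram \<gamma> = {(i, j). 1 \<le> i \<and> i \<le> plen \<gamma> \<and> 1 \<le> j \<and> j \<le> part \<gamma> i}"

definition conj_part :: "nat list \<Rightarrow> nat \<Rightarrow> nat" where
  "conj_part \<gamma> j = card {i. (i, j) \<in> diagram \<gamma>}"

definition arm :: "nat list \<Rightarrow> nat \<times> nat \<Rightarrow> int" where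
  "arm \<gamma> = (\<lambda>(i, j). int (part \<gamma> i) - int j)"

definition leg :: "nat list \<Rightarrow> nat \<times> nat \<Rightarrow> int" where
  "leg \<gamma> = (\<lambda>(i, j). int (conj_part \<gamma> j) - int i)"

definition dinv :: "nat list \<Rightarrow> nat" where
  "dinv \<gamma> = card {c \<in> diagram \<gamma>. arm \<gamma> c - leg \<gamma> c \<in> {0, 1}}"

text \<open>The list \<open>rev [0..<n]\<close> is the staircase \<open>(n-1, n-2, ..., 1, 0)\<close>.\<close>

definition DP :: "nat \<Rightarrow> nat list set" where
  "DP n = {\<gamma>. is_partition \<gamma> \<and> diagram \<gamma> \<subseteq> diagram (rev [0..<n])}"

definition area :: "nat \<Rightarrow> nat list \<Rightarrow> int" where
  "area n \<gamma> = int (n choose 2) - int (psize \<gamma>)"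

text \<open>Maps on \<open>B\<close> are taken extensional, so that uniqueness concerns only their values on \<open>B\<close>.\<close>

definition n_opposite :: "nat \<Rightarrow> nat list set \<Rightarrow> nat list set \<Rightarrow> bool" where
  "n_opposite n B C \<longleftrightarrow> B \<subseteq> DP n \<and> C \<subseteq> DP n \<and>
     (\<exists>!g. g \<in> extensional B \<and> bij_betw g B C \<and>
        (\<forall>\<gamma>\<in>B. area n \<gamma> = int (dinv (g \<gamma>)) \<and> int (dinv \<gamma>) = area n (g \<gamma>)))"

definition nu :: "nat list \<Rightarrow> nat list" where
  "nu \<gamma> = (if part \<gamma> 1 \<le> plen \<gamma> + 2
           then strip ((plen \<gamma> + 1) # map (\<lambda>x. x - 1) \<gamma>)
           else undefined)"

text \<open>\<open>k mod l\<close> is the remainder \<open>r\<^sub>k\<^sub>,\<^sub>l\<close>; only \<open>l > 0\<close> is meaningful.\<close>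

definition II :: "nat \<Rightarrow> nat \<Rightarrow> nat list" where
  "II k l = padd (replicate (1 + k div l) l @ rev [1..<l])
                 (replicate (1 + k div l) 0 @ replicate (k mod l) 1 @ replicate (l - 1 - k mod l) 0)"

definition cell_less :: "nat \<times> nat \<Rightarrow> nat \<times> nat \<Rightarrow> bool" where
  "cell_less = (\<lambda>(i, j) (i', j'). i + j < i' + j' \<or> i + j = i' + j' \<and> i < i')"

text \<open>The \<open>q\<close>-th largest cell, for \<open>1 \<le> q \<le> psize \<gamma>\<close>: exactly \<open>q - 1\<close> cells are larger.\<close>

definition u_cell :: "nat \<Rightarrow> nat list \<Rightarrow> nat \<times> nat" where
  "u_cell q \<gamma> = (THE c. c \<in> diagram \<gamma> \<and> card {d \<in> diagram \<gamma>. cell_less c d} = q - 1)"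

definition remove_cell :: "nat list \<Rightarrow> nat \<times> nat \<Rightarrow> nat list" where
  "remove_cell \<gamma> c = (THE \<mu>. is_partition \<mu> \<and> diagram \<mu> = diagram \<gamma> - {c})"

definition gam :: "nat \<Rightarrow> nat \<Rightarrow> nat \<Rightarrow> nat list" where
  "gam p q i = (if i \<le> q - 1 then padd (II ((q - 1) * p) i) (II (p - 2) 1)
                else remove_cell (II (q * (p - 1)) (i + 1)) (u_cell q (II (q * (p - 1)) (i + 1))))"

definition RR :: "nat \<Rightarrow> nat \<Rightarrow> nat \<Rightarrow> nat list set" where
  "RR p q i = (if i \<le> q - 2 then {(nu ^^ m) (gam p q i) | m. m \<le> i}
               else {(nu ^^ m) (gam p q i) | m. m \<le> i + 1})"

text \<open>Meaningful for \<open>p, q \<ge> 2\<close>, where no subtraction above is truncated.\<close>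

definition DD :: "nat \<Rightarrow> nat \<Rightarrow> nat list set" where
  "DD p q = (\<Union>i\<in>{1..}. RR p q i)"

end

theory Submission
  imports Defs
begin

text \<open>
  With column lengths \<open>c j\<close> put \<open>a j = c j + j\<close>. Counting the steps of the boundary path by level
  expresses \<open>dinv\<close> through the pairs \<open>j < j'\<close> with \<open>a j' - a j \<in> {0, 1}\<close>, and shows that \<open>\<nu>\<close> raises
  both \<open>dinv\<close> and the size by 1. Hence \<open>\<D>(p,q)\<close> has exactly one element for each value
  \<open>k \<ge> 2\<close> of \<open>dinv\<close>, of size \<open>k + p q - 2\<close>, so that the unique candidate for the bijection
  sends \<open>k\<close> to \<open>k' = C(n,2) - p q + 2 - k\<close>.

  The levels \<open>a j\<close> also decide which elements lie in \<open>DP n\<close>. With \<open>T l = 1 + \<dots> + l\<close>, those values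
  of \<open>k\<close> form the union of the intervals \<open>[T l + 1, l n - T l + 1 - (q-1) p]\<close> for \<open>1 \<le> l \<le> q - 2\<close> and
  \<open>[T l + 1 - q, l n - T l + 1 - q p]\<close> for \<open>l \<ge> q\<close>. The reflection \<open>k \<mapsto> k'\<close> maps the \<open>l\<close>-th interval of
  either kind for \<open>(p,q)\<close> to the \<open>(n-1-l)\<close>-th interval of the other kind for \<open>(q,p)\<close>; those of
  the first kind with index outside the stated range are covered by the second kind.
\<close>

section \<open>Partitions and their columns\<close>

lemma strip_partition: "is_partition \<gamma> \<Longrightarrow> strip \<gamma> = \<gamma>"
  unfolding is_partition_def strip_def by (induction \<gamma>) auto

lemma part_Cons: "part (x # xs) i = (if i = 1 then x else if i = 0 then 0 else part xs (i - 1))"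
  by (cases i; cases "i - 1") (auto simp: part_def)

lemma part_eq_0: "length \<gamma> < i \<Longrightarrow> part \<gamma> i = 0"
  by (simp add: part_def)

lemma part_strip: "sorted_wrt (\<ge>) \<gamma> \<Longrightarrow> part (strip \<gamma>) i = part \<gamma> i"
proof (induction \<gamma> arbitrary: i)
  case (Cons x xs)
  show ?case
  proof (cases "x = 0")
    case True
    with Cons.prems have z: "\<forall>y\<in>set xs. y = 0" by auto
    have s: "strip (x # xs) = []" using True z by (auto simp: strip_def filter_empty_conv)
    show ?thesis unfolding s using True z by (auto simp: part_def nth_Cons')
  next
    case False
    then have "strip (x # xs) = x # strip xs" by (simp add: strip_def)
    then show ?thesis using Cons by (simp add: part_Cons)
  qed
qed (simp add: strip_def)

lemma is_partition_strip: "sorted_wrt (\<ge>) \<gamma> \<Longrightarrow> is_partition (strip \<gamma>)"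
  by (auto simp: is_partition_def strip_def sorted_wrt_filter)

lemma is_partitionI:
  assumes "\<And>i. 1 \<le> i \<Longrightarrow> part \<gamma> (Suc i) \<le> part \<gamma> i"
    and "\<And>i. 1 \<le> i \<Longrightarrow> i \<le> length \<gamma> \<Longrightarrow> 0 < part \<gamma> i"
  shows "is_partition \<gamma>"
proof -
  have "\<gamma> ! Suc i \<le> \<gamma> ! i" if "Suc i < length \<gamma>" for i
    using assms(1)[of "Suc i"] that by (simp add: part_def)
  then have "sorted_wrt (\<ge>) \<gamma>"
    by (subst sorted_wrt_iff_nth_Suc_transp) (auto simp: transp_def)
  moreover have "0 \<notin> set \<gamma>"
  proof
    assume "0 \<in> set \<gamma>"
    then obtain i where "i < length \<gamma>" "\<gamma> ! i = 0" by (auto simp: in_set_conv_nth)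
    then show False using assms(2)[of "Suc i"] by (simp add: part_def)
  qed
  ultimately show ?thesis by (simp add: is_partition_def)
qed

lemma partition_part_pos:
  "is_partition \<gamma> \<Longrightarrow> 0 < part \<gamma> i \<longleftrightarrow> 1 \<le> i \<and> i \<le> length \<gamma>"
  by (auto simp: is_partition_def part_def in_set_conv_nth)

lemma diagram_partition:
  "is_partition \<gamma> \<Longrightarrow> diagram \<gamma> = {(i, j). 1 \<le> i \<and> 1 \<le> j \<and> j \<le> part \<gamma> i}"
  using partition_part_pos[of \<gamma>] by (force simp: diagram_def plen_def strip_partition)

text \<open>Supplies the uniqueness behind the definite description in
  \<open>remove_cell\<close>.\<close>

lemma diagram_inject:
  assumes "is_partition \<gamma>" "is_partition \<mu>" "diagram \<gamma> = diagram \<mu>"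
  shows "\<gamma> = \<mu>"
proof -
  have le: "part \<alpha> i \<le> part \<beta> i"
    if "is_partition \<alpha>" "is_partition \<beta>" "diagram \<alpha> = diagram \<beta>" "1 \<le> i" for \<alpha> \<beta> i
  proof (cases "part \<alpha> i = 0")
    case False
    with that(1,4) have "(i, part \<alpha> i) \<in> diagram \<alpha>" by (simp add: diagram_partition)
    with that(3) have "(i, part \<alpha> i) \<in> diagram \<beta>" by simp
    with that(2) show ?thesis by (simp add: diagram_partition)
  qed simp
  have eq: "part \<gamma> i = part \<mu> i" if "1 \<le> i" for i
    using le[of \<gamma> \<mu> i] le[of \<mu> \<gamma> i] assms that by simp
  have "1 \<le> i \<and> i \<le> length \<gamma> \<longleftrightarrow> 1 \<le> i \<and> i \<le> length \<mu>" for i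
    using eq[of i] partition_part_pos[OF assms(1), of i] partition_part_pos[OF assms(2), of i] by auto
  then have "length \<gamma> = length \<mu>"
    by (metis le_antisym le_refl linorder_not_le not_less_eq_eq zero_le One_nat_def le_zero_eq)
  then show ?thesis
  proof (rule nth_equalityI)
    show "\<gamma> ! i = \<mu> ! i" if "i < length \<gamma>" for i
      using eq[of "Suc i"] that \<open>length \<gamma> = length \<mu>\<close> by (simp add: part_def)
  qed
qed

text \<open>\<open>N\<close> is any bound on the number of nonempty columns, not their exact number,
  so that trailing empty columns can be included; \<open>nu\<close> turns some of these into
  nonempty ones. The value \<open>c 0\<close> is left free.\<close>

definition has_cols :: "nat list \<Rightarrow> nat \<Rightarrow> (nat \<Rightarrow> nat) \<Rightarrow> bool" where
  "has_cols \<gamma> N c \<longleftrightarrow> is_partition \<gamma> \<and> (\<forall>j>N. c j = 0) \<and>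
     (\<forall>i j. 1 \<le> i \<longrightarrow> 1 \<le> j \<longrightarrow> (j \<le> part \<gamma> i \<longleftrightarrow> i \<le> c j))"

lemma has_colsD:
  assumes "has_cols \<gamma> N c"
  shows "is_partition \<gamma>" "\<And>j. N < j \<Longrightarrow> c j = 0"
    "\<And>i j. 1 \<le> i \<Longrightarrow> 1 \<le> j \<Longrightarrow> j \<le> part \<gamma> i \<longleftrightarrow> i \<le> c j"
  using assms by (auto simp: has_cols_def)

lemma has_cols_diagram:
  assumes "has_cols \<gamma> N c"
  shows "diagram \<gamma> = {(i, j). 1 \<le> i \<and> 1 \<le> j \<and> i \<le> c j}"
  using has_colsD[OF assms] by (auto simp: diagram_partition)

lemma has_cols_antimono:
  assumes "has_cols \<gamma> N c" "1 \<le> j" "j \<le> k"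
  shows "c k \<le> c j"
proof (cases "c k = 0")
  case False
  then have "k \<le> part \<gamma> (c k)" using has_colsD(3)[OF assms(1), of "c k" k] assms by auto
  then have "j \<le> part \<gamma> (c k)" using assms by simp
  then show ?thesis using has_colsD(3)[OF assms(1), of "c k" j] False assms by auto
qed simp

lemma has_cols_conj_part:
  assumes "has_cols \<gamma> N c" "1 \<le> j"
  shows "conj_part \<gamma> j = c j"
proof -
  have "{i. (i, j) \<in> diagram \<gamma>} = {1..c j}" using assms by (auto simp: has_cols_diagram)
  then show ?thesis by (simp add: conj_part_def)
qed

lemma has_cols_length:
  assumes "has_cols \<gamma> N c"
  shows "length \<gamma> = c 1" "plen \<gamma> = c 1"
proof -
  have "1 \<le> i \<and> i \<le> length \<gamma> \<longleftrightarrow> 1 \<le> i \<and> i \<le> c 1" for i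
    using has_colsD(3)[OF assms, of i 1] partition_part_pos[OF has_colsD(1)[OF assms], of i] by auto
  then show "length \<gamma> = c 1"
    by (metis le_antisym le_refl linorder_not_le not_less_eq_eq zero_le One_nat_def le_zero_eq)
  then show "plen \<gamma> = c 1" using has_colsD(1)[OF assms] by (simp add: plen_def strip_partition)
qed

lemma part_eq_iff:
  assumes "has_cols \<gamma> N c" "1 \<le> i" "1 \<le> j"
  shows "part \<gamma> i = j \<longleftrightarrow> c (Suc j) < i \<and> i \<le> c j"
  using has_colsD(3)[OF assms(1), of i j] has_colsD(3)[OF assms(1), of i "Suc j"] assms by auto

text \<open>Follow the boundary path of \<open>\<gamma>\<close> from the far right to the bottom of column \<open>j\<close>, at level
  \<open>c j + j\<close>: its horizontal steps lower the level \<open>x + y\<close> and its vertical steps raise it.\<close>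

lemma boundary_levels:
  assumes "has_cols \<gamma> N c" "1 \<le> j"
  shows "card {j'. j < j' \<and> c j' + j' = t} =
    card {i \<in> {1..c j}. part \<gamma> i + i = t} + (if c j + j < t then 1 else 0)"
  using assms(2)
proof (induction "N - j" arbitrary: j)
  case 0
  then have "c j' = 0" if "j < j'" for j' using that has_colsD(2)[OF assms(1), of j'] by simp
  \<comment> \<open>To the right of \<open>j\<close> all columns are empty, so column
    \<open>j'\<close> has level \<open>j'\<close> itself, and the level \<open>t\<close> occurs
    exactly when \<open>j < t\<close>.\<close>
  then have l: "{j'. j < j' \<and> c j' + j' = t} = (if j < t then {t} else {})" by auto
  show ?case
  proof (cases "N < j")
    case True
    then show ?thesis unfolding l using has_colsD(2)[OF assms(1), of j] by simp
  next
    case False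
    then have "part \<gamma> i = j" if "i \<in> {1..c j}" for i
      using part_eq_iff[OF assms(1), of i j] has_colsD(2)[OF assms(1), of "Suc j"] that 0 by auto
    then have "{i \<in> {1..c j}. part \<gamma> i + i = t} = {i \<in> {1..c j}. j + i = t}"
      by (intro Collect_cong) (simp cong: conj_cong)
    also have "\<dots> = (if j < t \<and> t \<le> c j + j then {t - j} else {})"
      by auto
    finally have r: "{i \<in> {1..c j}. part \<gamma> i + i = t} =
      (if j < t \<and> t \<le> c j + j then {t - j} else {})" .
    show ?thesis unfolding l r by auto
  qed
next
  case (Suc x)
  have fin: "finite {j'. k < j' \<and> c j' + j' = t}" for k
    by (rule finite_subset[of _ "{..t}"]) auto
  have "{j'. j < j' \<and> c j' + j' = t} =
      (if c (Suc j) + Suc j = t then {Suc j} else {}) \<union> {j'. Suc j < j' \<and> c j' + j' = t}" (is "?X = ?Y")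
  proof (rule set_eqI)
    show "j' \<in> ?X \<longleftrightarrow> j' \<in> ?Y" for j' by (cases "j' = Suc j") auto
  qed
  then have l: "card {j'. j < j' \<and> c j' + j' = t} =
      (if c (Suc j) + Suc j = t then 1 else 0) + card {j'. Suc j < j' \<and> c j' + j' = t}"
    using fin by simp
  have le: "c (Suc j) \<le> c j" using has_cols_antimono[OF assms(1), of j "Suc j"] Suc by simp
  have *: "part \<gamma> i + i = t \<longleftrightarrow> i = t - j \<and> j \<le> t" if "c (Suc j) < i" "i \<le> c j" for i
    using part_eq_iff[OF assms(1), of i j] that Suc by auto
  \<comment> \<open>Passing from column \<open>Suc j\<close> to column \<open>j\<close> adds the
    rows \<open>i\<close> with \<open>c (Suc j) < i\<close> and \<open>i \<le> c j\<close>. They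
    have part exactly \<open>j\<close>, so they carry the consecutive levels \<open>j + i\<close>,
    at most one of which equals \<open>t\<close>.\<close>
  have "{i \<in> {1..c j}. part \<gamma> i + i = t} = {i \<in> {1..c (Suc j)}. part \<gamma> i + i = t} \<union>
      (if c (Suc j) + j < t \<and> t \<le> c j + j then {t - j} else {})" (is "_ = ?A \<union> ?B")
  proof (intro set_eqI iffI)
    fix i assume i: "i \<in> {i \<in> {1..c j}. part \<gamma> i + i = t}"
    show "i \<in> ?A \<union> ?B"
      using i *[of i] by (cases "i \<le> c (Suc j)") auto
  next
    fix i assume i: "i \<in> ?A \<union> ?B"
    then consider "i \<in> ?A" | "c (Suc j) < i" "i \<le> c j" "i = t - j" "j \<le> t"
      by (auto split: if_splits)
    then show "i \<in> {i \<in> {1..c j}. part \<gamma> i + i = t}"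
      using *[of i] le by cases auto
  qed
  moreover have "?A \<inter> ?B = {}" by auto
  ultimately have r: "card {i \<in> {1..c j}. part \<gamma> i + i = t} = card ?A +
      (if c (Suc j) + j < t \<and> t \<le> c j + j then 1 else 0)"
    by (simp add: card_Un_disjoint)
  show ?case unfolding l r using Suc.hyps(1)[of "Suc j"] Suc le by auto
qed

text \<open>For a cell in row \<open>i\<close> and column \<open>j\<close>, arm minus leg is
  \<open>(part \<gamma> i + i) - (c j + j)\<close>. Applying \<open>boundary_levels\<close> with
  \<open>t = c j + j\<close> and \<open>t = c j + j + 1\<close> trades the rows of column
  \<open>j\<close> for later columns. Only the second application carries the extra 1, and over all
  columns these add up to \<open>N\<close>.\<close>

lemma dinv_cols:
  assumes "has_cols \<gamma> N c"
  shows "dinv \<gamma> + N = (\<Sum>j = 1..N. card {j'. j < j' \<and> c j' + j' \<in> {c j + j, c j + j + 1}})"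
proof -
  let ?S = "\<lambda>j. {i \<in> {1..c j}. part \<gamma> i + i \<in> {c j + j, c j + j + 1}}"
  have "{d \<in> diagram \<gamma>. arm \<gamma> d - leg \<gamma> d \<in> {0, 1}} =
      (\<lambda>(j, i). (i, j)) ` (SIGMA j:{1..N}. ?S j)" (is "?L = ?R")
  proof (intro set_eqI iffI)
    fix d assume d: "d \<in> ?L"
    obtain i j where ij: "d = (i, j)" by force
    have 1: "1 \<le> i" "1 \<le> j" "i \<le> c j" using d ij by (auto simp: has_cols_diagram[OF assms])
    then have "j \<le> N" using has_colsD(2)[OF assms, of j] by (cases "N < j") auto
    moreover have "i \<in> ?S j" using d ij 1 has_cols_conj_part[OF assms, of j]
      by (auto simp: arm_def leg_def)
    ultimately show "d \<in> ?R" using ij 1 by (auto simp: image_iff)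
  next
    fix d assume d: "d \<in> ?R"
    then obtain i j where ij: "d = (i, j)" "1 \<le> j" "i \<in> ?S j" by auto
    then show "d \<in> ?L" using has_cols_conj_part[OF assms, of j]
      by (auto simp: has_cols_diagram[OF assms] arm_def leg_def)
  qed
  moreover have "inj_on (\<lambda>(j, i). (i, j)) X" for X :: "(nat \<times> nat) set"
    by (auto simp: inj_on_def)
  ultimately have "dinv \<gamma> = card (SIGMA j:{1..N}. ?S j)" unfolding dinv_def
    by (simp only: card_image)
  also have "\<dots> = (\<Sum>j = 1..N. card (?S j))" by simp
  finally have 1: "dinv \<gamma> + N = (\<Sum>j = 1..N. card (?S j) + 1)" by (subst sum.distrib) simp
  have "card (?S j) + 1 = card {j'. j < j' \<and> c j' + j' \<in> {c j + j, c j + j + 1}}"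
    if "j \<in> {1..N}" for j
  proof -
    have fin: "finite {j'. j < j' \<and> c j' + j' = t}" for t
      by (rule finite_subset[of _ "{..t}"]) auto
    have "?S j = {i \<in> {1..c j}. part \<gamma> i + i = c j + j} \<union> {i \<in> {1..c j}. part \<gamma> i + i = c j + j + 1}"
      by auto
    then have "card (?S j) = card {i \<in> {1..c j}. part \<gamma> i + i = c j + j} +
        card {i \<in> {1..c j}. part \<gamma> i + i = c j + j + 1}"
      by (simp only:) (rule card_Un_disjoint, auto)
    moreover have "{j'. j < j' \<and> c j' + j' \<in> {c j + j, c j + j + 1}} =
        {j'. j < j' \<and> c j' + j' = c j + j} \<union> {j'. j < j' \<and> c j' + j' = c j + j + 1}" by auto
    then have "card {j'. j < j' \<and> c j' + j' \<in> {c j + j, c j + j + 1}} =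
        card {j'. j < j' \<and> c j' + j' = c j + j} + card {j'. j < j' \<and> c j' + j' = c j + j + 1}"
      by (simp only:) (rule card_Un_disjoint, use fin in auto)
    ultimately show ?thesis
      using boundary_levels[OF assms, of j "c j + j"] boundary_levels[OF assms, of j "c j + j + 1"] that
      by simp
  qed
  with 1 show ?thesis by simp
qed

section \<open>Size and staircase containment read off the columns\<close>

lemma psize_cols:
  assumes "has_cols \<gamma> N c"
  shows "psize \<gamma> = (\<Sum>j = 1..N. c j)"
proof -
  have "psize \<gamma> = (\<Sum>i < length \<gamma>. \<gamma> ! i)" by (simp add: psize_def sum_list_sum_nth atLeast0LessThan)
  also have "\<dots> = (\<Sum>i = 1..length \<gamma>. part \<gamma> i)"
    by (rule sum.reindex_bij_witness[of _ "\<lambda>i. i - 1" Suc]) (auto simp: part_def)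
  also have "\<dots> = card (SIGMA i:{1..length \<gamma>}. {1..part \<gamma> i})" by simp
  also have "\<dots> = card (SIGMA j:{1..N}. {1..c j})"
  proof (rule bij_betw_same_card[of "\<lambda>(i, j). (j, i)"],
      rule bij_betw_byWitness[where f' = "\<lambda>(i, j). (j, i)"])
    have "j \<le> N" if "i \<le> c j" "1 \<le> i" for i j
      using has_colsD(2)[OF assms, of j] that by (cases "N < j") auto
    then show "(\<lambda>(i, j). (j, i)) ` (SIGMA i:{1..length \<gamma>}. {1..part \<gamma> i}) \<subseteq> (SIGMA j:{1..N}. {1..c j})"
      using has_colsD(3)[OF assms] by auto
    have "i \<le> length \<gamma>" if "j \<le> part \<gamma> i" "1 \<le> j" for i j
      using that by (cases "length \<gamma> < i") (auto simp: part_eq_0)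
    then show "(\<lambda>(i, j). (j, i)) ` (SIGMA j:{1..N}. {1..c j}) \<subseteq> (SIGMA i:{1..length \<gamma>}. {1..part \<gamma> i})"
      using has_colsD(3)[OF assms] by fastforce
  qed auto
  also have "\<dots> = (\<Sum>j = 1..N. c j)" by simp
  finally show ?thesis .
qed

lemma diagram_staircase: "diagram (rev [0..<n]) = {(i, j). 1 \<le> i \<and> 1 \<le> j \<and> i + j \<le> n}"
proof -
  have "filter (\<lambda>x. x \<noteq> 0) [0..<n] = [1..<n]"
    by (induction n) auto
  then have "plen (rev [0..<n]) = n - 1"
    by (simp add: plen_def strip_def rev_filter[symmetric])
  moreover have "part (rev [0..<n]) i = n - i" if "1 \<le> i" for i
    using that by (auto simp: part_def rev_nth)
  ultimately show ?thesis by (auto simp: diagram_def)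
qed

lemma DP_cols:
  assumes "has_cols \<gamma> N c"
  shows "\<gamma> \<in> DP n \<longleftrightarrow> (\<forall>j \<ge> 1. 1 \<le> c j \<longrightarrow> c j + j \<le> n)"
proof
  assume "\<gamma> \<in> DP n"
  then have "diagram \<gamma> \<subseteq> {(i, j). 1 \<le> i \<and> 1 \<le> j \<and> i + j \<le> n}"
    by (simp add: DP_def diagram_staircase)
  then have "i + j \<le> n" if "1 \<le> i" "1 \<le> j" "i \<le> c j" for i j
    using that by (auto simp: has_cols_diagram[OF assms])
  then show "\<forall>j \<ge> 1. 1 \<le> c j \<longrightarrow> c j + j \<le> n" by simp
next
  assume "\<forall>j \<ge> 1. 1 \<le> c j \<longrightarrow> c j + j \<le> n"
  then have "i + j \<le> n" if "1 \<le> i" "1 \<le> j" "i \<le> c j" for i j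
    using that by (meson add_le_mono1 le_trans)
  then show "\<gamma> \<in> DP n" using has_colsD(1)[OF assms]
    by (auto simp: DP_def diagram_staircase has_cols_diagram[OF assms])
qed

section \<open>The map \<open>\<nu>\<close> in terms of columns\<close>

text \<open>The witness is the conjugate: row \<open>i\<close> gets as many cells as there are
  columns of length at least \<open>i\<close>. It later supplies the partition left after removing a
  corner.\<close>

lemma has_cols_exists:
  assumes anti: "\<And>j. 1 \<le> j \<Longrightarrow> c (Suc j) \<le> c j" and zero: "\<And>j. N < j \<Longrightarrow> c j = 0"
  shows "\<exists>\<gamma>. has_cols \<gamma> N c"
proof -
  define f where "f i = card {j \<in> {1..N}. i \<le> c j}" for i
  have le: "c k \<le> c j" if "1 \<le> j" "j \<le> k" for j k
    using that(2,1) by (induction rule: dec_induct) (auto intro: order_trans[OF anti])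
  have f: "j \<le> f i \<longleftrightarrow> i \<le> c j" if "1 \<le> i" "1 \<le> j" for i j
  proof
    assume "i \<le> c j"
    then have "{1..j} \<subseteq> {j \<in> {1..N}. i \<le> c j}"
      using le[of _ j] zero[of j] that by (cases "N < j") (auto intro: order_trans)
    from card_mono[OF _ this] show "j \<le> f i" by (simp add: f_def)
  next
    assume *: "j \<le> f i"
    show "i \<le> c j"
    proof (rule ccontr)
      assume "\<not> i \<le> c j"
      then have "{j \<in> {1..N}. i \<le> c j} \<subseteq> {1..<j}"
        using le[OF that(2)] by (auto simp: not_le) (meson leD le_trans not_le)
      from card_mono[OF _ this] have "f i \<le> j - 1" by (simp add: f_def)
      with * that show False by simp
    qed
  qed
  define \<gamma> where "\<gamma> = map f [1..<Suc (c 1)]"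
  have p: "part \<gamma> i = (if 1 \<le> i \<and> i \<le> c 1 then f i else 0)" for i
    by (auto simp: part_def \<gamma>_def simp del: upt_Suc)
  have fm: "f (Suc i) \<le> f i" for i unfolding f_def by (rule card_mono) auto
  have "is_partition \<gamma>"
  proof (rule is_partitionI)
    show "part \<gamma> (Suc i) \<le> part \<gamma> i" if "1 \<le> i" for i using fm[of i] that by (simp add: p)
    show "0 < part \<gamma> i" if "1 \<le> i" "i \<le> length \<gamma>" for i
      using f[of i 1] that p[of i] by (simp add: \<gamma>_def del: upt_Suc)
  qed
  moreover have "j \<le> part \<gamma> i \<longleftrightarrow> i \<le> c j" if "1 \<le> i" "1 \<le> j" for i j
    using f[OF that] le[of 1 j] that by (auto simp: p)
  ultimately have "has_cols \<gamma> N c" using zero by (simp add: has_cols_def)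
  then show ?thesis by blast
qed

text \<open>Subtracting 1 from every part deletes the first column, and the new first row puts one
  cell on top of each of the columns \<open>1\<close> to \<open>c 1 + 1\<close>. The bound on
  \<open>N\<close> ensures that \<open>nu\<close> is given by its formula and that the new row is at
  least as long as the next one.\<close>

lemma nu_cols:
  assumes "has_cols \<gamma> N c" "N \<le> c 1 + 2"
  shows "has_cols (nu \<gamma>) (c 1 + 1) (\<lambda>j. if j \<le> c 1 + 1 then c (Suc j) + 1 else 0)"
proof -
  have part: "part \<gamma> i \<le> N" if "1 \<le> i" for i
    using has_colsD(2)[OF assms(1), of "part \<gamma> i"] has_colsD(3)[OF assms(1), of i "part \<gamma> i"] that
    by (cases "N < part \<gamma> i") auto
  have nth: "x \<le> c 1 + 2" if x: "x \<in> set \<gamma>" for x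
  proof -
    obtain i where "i < length \<gamma>" "x = \<gamma> ! i" using x by (metis in_set_conv_nth)
    then have "x = part \<gamma> (Suc i)" by (simp add: part_def)
    then show ?thesis using part[of "Suc i"] assms(2) by simp
  qed
  let ?\<mu> = "(c 1 + 1) # map (\<lambda>x. x - 1) \<gamma>"
  have nu: "nu \<gamma> = strip ?\<mu>"
    using part[of 1] assms(2) by (simp add: nu_def has_cols_length[OF assms(1)])
  have "sorted_wrt (\<ge>) (map (\<lambda>x. x - 1) \<gamma>)"
    using has_colsD(1)[OF assms(1)] unfolding is_partition_def sorted_wrt_map
    by (auto elim!: sorted_wrt_mono_rel[rotated] intro: diff_le_mono)
  then have srt: "sorted_wrt (\<ge>) ?\<mu>" using nth by fastforce
  have p: "part (nu \<gamma>) i = (if i = 1 then c 1 + 1 else part \<gamma> (i - 1) - 1)" if "1 \<le> i" for i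
    unfolding nu part_strip[OF srt] using that by (auto simp: part_Cons) (auto simp: part_def)
  have "j \<le> part (nu \<gamma>) i \<longleftrightarrow> i \<le> (if j \<le> c 1 + 1 then c (Suc j) + 1 else 0)"
    if "1 \<le> i" "1 \<le> j" for i j
  proof (cases "i = 1")
    case False
    have "j \<le> part \<gamma> (i - 1) - 1 \<longleftrightarrow> Suc j \<le> part \<gamma> (i - 1)" using that by auto
    moreover have "Suc j \<le> part \<gamma> (i - 1) \<longleftrightarrow> i - 1 \<le> c (Suc j)"
      using has_colsD(3)[OF assms(1), of "i - 1" "Suc j"] that False by simp
    moreover have "j \<le> c 1 + 1" if "i - 1 \<le> c (Suc j)"
      using has_colsD(2)[OF assms(1), of "Suc j"] that False \<open>1 \<le> i\<close> assms(2)
      by (cases "N < Suc j") auto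
    ultimately show ?thesis using p[OF that(1)] False that by auto
  qed (use p[of 1] in auto)
  then show ?thesis using is_partition_strip[OF srt] nu by (auto simp: has_cols_def)
qed

lemma psize_nu:
  assumes "has_cols \<gamma> N c" "N \<le> c 1 + 2"
  shows "psize (nu \<gamma>) = psize \<gamma> + 1"
proof -
  \<comment> \<open>The bound becomes \<open>c 1 + 2\<close> so that the new columns are exactly the
    columns \<open>2\<close> to \<open>c 1 + 2\<close>, each with one cell added.\<close>
  have h: "has_cols \<gamma> (c 1 + 2) c"
    using assms by (auto simp: has_cols_def)
  have "psize (nu \<gamma>) = (\<Sum>j = 1..c 1 + 1. c (Suc j) + 1)"
    using psize_cols[OF nu_cols[OF assms]] by simp
  also have "\<dots> = (\<Sum>j = 1..c 1 + 1. c (Suc j)) + (c 1 + 1)" by (subst sum.distrib) simp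
  also have "(\<Sum>j = 1..c 1 + 1. c (Suc j)) = (\<Sum>j = Suc 1..c 1 + 2. c j)"
    using sum.shift_bounds_cl_Suc_ivl[of c 1 "c 1 + 1"] by simp
  also have "\<dots> + (c 1 + 1) = (\<Sum>j = 1..c 1 + 2. c j) + 1"
    using sum.atLeast_Suc_atMost[of 1 "c 1 + 2" c] by simp
  finally show ?thesis using psize_cols[OF h] by simp
qed

text \<open>With \<open>a j = c j + j\<close>, the map \<open>\<nu>\<close> turns \<open>a 1, a 2, \<dots>\<close> into \<open>a 2, a 3, \<dots>\<close> with an extra entry
  \<open>a 1 + 1\<close> inserted where the entries stabilise to \<open>a j = j\<close>.\<close>

lemma dinv_nu:
  assumes "has_cols \<gamma> N c" "N \<le> c 1 + 2"
  shows "dinv (nu \<gamma>) = dinv \<gamma> + 1"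
proof -
  define A where "A = c 1 + 1"
  define a where "a j = c j + j" for j
  define a' where "a' j = (if j \<le> A then a (Suc j) else j)" for j
  have h: "has_cols \<gamma> (Suc A) c" using assms by (auto simp: has_cols_def A_def)
  have a1: "a 1 = A" by (simp add: a_def A_def)
  have aj: "j \<le> a j" for j by (simp add: a_def)
  have az: "a j = j" if "j > Suc A" for j using has_colsD(2)[OF h that] by (simp add: a_def)
  have fin: "finite {j'. j < j' \<and> a j' \<in> {t, t + 1}}" for j t
  proof (rule finite_subset)
    show "{j'. j < j' \<and> a j' \<in> {t, t + 1}} \<subseteq> {..t + 1}"
      using aj by (auto intro: order_trans[OF aj])
  qed simp
  have a': "(if j \<le> c 1 + 1 then c (Suc j) + 1 else 0) + j = a' j" for j
    by (simp add: a'_def a_def A_def)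
  have 1: "dinv \<gamma> + Suc A = (\<Sum>j = 1..Suc A. card {j'. j < j' \<and> a j' \<in> {a j, a j + 1}})"
    using dinv_cols[OF h] by (simp add: a_def)
  have 2: "dinv (nu \<gamma>) + A = (\<Sum>j = 1..A. card {j'. j < j' \<and> a' j' \<in> {a' j, a' j + 1}})"
    using dinv_cols[OF nu_cols[OF assms]] unfolding a' by (simp add: A_def)
  \<comment> \<open>The dropped entry is \<open>a 1 = A\<close>; the inserted one is
    \<open>A + 1\<close>, at position \<open>Suc A\<close>. The map \<open>?g\<close> carries the
    index of each surviving entry to its new position, so the count for \<open>Suc j\<close> changes
    only by the inserted entry.\<close>
  have 3: "card {j'. j < j' \<and> a' j' \<in> {a' j, a' j + 1}} =
      card {j'. Suc j < j' \<and> a j' \<in> {a (Suc j), a (Suc j) + 1}} + (if a (Suc j) \<in> {A, A + 1} then 1 else 0)"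
    if "j \<in> {1..A}" for j
  proof -
    let ?t = "a (Suc j)"
    let ?S = "{j'. Suc j < j' \<and> a j' \<in> {?t, ?t + 1}}"
    let ?g = "\<lambda>k. if k \<le> Suc A then k - 1 else k"
    have t: "a' j = ?t" using that by (simp add: a'_def)
    have img: "{j'. j < j' \<and> a' j' \<in> {?t, ?t + 1}} =
        ?g ` ?S \<union> (if ?t \<in> {A, A + 1} then {Suc A} else {})" (is "?L = ?R")
    proof (intro set_eqI iffI)
      fix x assume x: "x \<in> ?L"
      consider "x \<le> A" | "x = Suc A" | "x > Suc A" by linarith
      then show "x \<in> ?R"
      proof cases
        case 1
        then have "Suc x \<in> ?S" "x = ?g (Suc x)" using x by (auto simp: a'_def)
        then show ?thesis by blast
      next
        case 2
        then show ?thesis using x by (auto simp: a'_def)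
      next
        case 3
        then have "x \<in> ?S" "x = ?g x" using x az[OF 3] that by (auto simp: a'_def)
        then show ?thesis by blast
      qed
    next
      fix x assume x: "x \<in> ?R"
      show "x \<in> ?L"
      proof (cases "x \<in> ?g ` ?S")
        case True
        then obtain k where k: "k \<in> ?S" "x = ?g k" by blast
        show ?thesis
        proof (cases "k \<le> Suc A")
          case True
          then show ?thesis using k by (auto simp: a'_def)
        next
          case False
          then show ?thesis using k az[of k] by (auto simp: a'_def)
        qed
      next
        case False
        with x have "?t \<in> {A, A + 1}" "x = Suc A" by (auto split: if_splits)
        then show ?thesis using that by (auto simp: a'_def)
      qed
    qed
    have "inj_on ?g ?S"
      by (rule inj_onI) (auto split: if_splits)
    then have "card (?g ` ?S) = card ?S" by (rule card_image)
    moreover have "Suc A \<notin> ?g ` ?S" by (auto split: if_splits)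
    ultimately show ?thesis unfolding t img using fin[of "Suc j" ?t] by auto
  qed
  \<comment> \<open>The pairs gained through the inserted entry \<open>a 1 + 1\<close> are as many
    as those lost with the first entry \<open>a 1\<close>. Hence the two sums agree, and
    \<open>dinv\<close> grows because \<open>A\<close> instead of \<open>Suc A\<close> is
    subtracted.\<close>
  have "(\<Sum>j = 1..A. if a (Suc j) \<in> {A, A + 1} then 1 else 0) = card {j \<in> {1..A}. a (Suc j) \<in> {A, A + 1}}"
    by (simp add: sum.If_cases Int_def)
  also have "\<dots> = card (Suc ` {j \<in> {1..A}. a (Suc j) \<in> {A, A + 1}})"
    by (rule card_image[symmetric]) simp
  also have "Suc ` {j \<in> {1..A}. a (Suc j) \<in> {A, A + 1}} = {j'. 1 < j' \<and> a j' \<in> {a 1, a 1 + 1}}"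
  proof (intro set_eqI iffI)
    fix x assume x: "x \<in> {j'. 1 < j' \<and> a j' \<in> {a 1, a 1 + 1}}"
    then have "x \<le> A + 1" using aj[of x] a1 by auto
    then have "x = Suc (x - 1)" "x - 1 \<in> {j \<in> {1..A}. a (Suc j) \<in> {A, A + 1}}" using x a1 by auto
    then show "x \<in> Suc ` {j \<in> {1..A}. a (Suc j) \<in> {A, A + 1}}" by blast
  qed (use a1 in auto)
  finally have 4: "(\<Sum>j = 1..A. if a (Suc j) \<in> {A, A + 1} then 1 else 0) =
      card {j'. 1 < j' \<and> a j' \<in> {a 1, a 1 + 1}}" .
  have "dinv (nu \<gamma>) + A = (\<Sum>j = 1..A. card {j'. Suc j < j' \<and> a j' \<in> {a (Suc j), a (Suc j) + 1}}) +
      card {j'. 1 < j' \<and> a j' \<in> {a 1, a 1 + 1}}"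
    unfolding 2 4[symmetric] sum.distrib[symmetric] by (rule sum.cong[OF refl 3])
  also have "(\<Sum>j = 1..A. card {j'. Suc j < j' \<and> a j' \<in> {a (Suc j), a (Suc j) + 1}}) =
      (\<Sum>j = Suc 1..Suc A. card {j'. j < j' \<and> a j' \<in> {a j, a j + 1}})"
    using sum.shift_bounds_cl_Suc_ivl[of "\<lambda>j. card {j'. j < j' \<and> a j' \<in> {a j, a j + 1}}" 1 A] by simp
  also have "\<dots> + card {j'. 1 < j' \<and> a j' \<in> {a 1, a 1 + 1}} = dinv \<gamma> + Suc A"
    unfolding 1 by (subst sum.atLeast_Suc_atMost[of 1 "Suc A"]) auto
  finally show ?thesis by simp
qed

text \<open>Column \<open>j\<close> of \<open>nu \<gamma>\<close> has level
  \<open>c (Suc j) + Suc j\<close>, so columns other than the first keep their levels. The bound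
  \<open>c 1 + 2\<close> is forced by the last new column, number \<open>c 1 + 1\<close>, and it
  covers both the deleted first column and every column that was empty before.\<close>

lemma DP_nu:
  assumes "has_cols \<gamma> N c" "N \<le> c 1 + 2"
  shows "nu \<gamma> \<in> DP n \<longleftrightarrow> \<gamma> \<in> DP n \<and> c 1 + 2 \<le> n"
proof -
  have *: "nu \<gamma> \<in> DP n \<longleftrightarrow> (\<forall>j \<ge> 1. j \<le> c 1 + 1 \<longrightarrow> c (Suc j) + 1 + j \<le> n)"
    unfolding DP_cols[OF nu_cols[OF assms]] by auto
  show ?thesis unfolding * DP_cols[OF assms(1)]
  proof (intro iffI conjI allI impI)
    assume l: "\<forall>j \<ge> 1. j \<le> c 1 + 1 \<longrightarrow> c (Suc j) + 1 + j \<le> n"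
    show n: "c 1 + 2 \<le> n" using l[rule_format, of "c 1 + 1"] by simp
    fix j assume j: "1 \<le> j" "1 \<le> c j"
    then have "j \<le> c 1 + 2" using has_colsD(2)[OF assms(1), of j] assms(2) by (cases "N < j") auto
    then show "c j + j \<le> n" using l[rule_format, of "j - 1"] n j by (cases "j = 1") auto
  next
    fix j assume r: "(\<forall>j\<ge>1. 1 \<le> c j \<longrightarrow> c j + j \<le> n) \<and> c 1 + 2 \<le> n" and j: "1 \<le> j" "j \<le> c 1 + 1"
    then show "c (Suc j) + 1 + j \<le> n"
      using r[THEN conjunct1, rule_format, of "Suc j"] by (cases "c (Suc j) = 0") auto
  qed
qed

text \<open>For \<open>m < M\<close> the \<open>m\<close>-th iterate starts with column
  \<open>Suc m\<close> of \<open>\<gamma>\<close> lengthened by \<open>m\<close>, so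
  \<open>c' 1 + 1\<close> is the level of that column. After an application of \<open>nu\<close> the
  number of columns is bounded by the level of the column just deleted, and \<open>drop\<close> then
  gives the condition for applying \<open>nu\<close> again; \<open>large\<close> keeps the columns
  still to come under the new row. Each application adds to the \<open>DP\<close> condition the
  strict inequality for the level of the column that it deletes.\<close>

lemma nu_iterate:
  assumes cols: "has_cols \<gamma> N c" and N: "N \<le> c 1 + 2" and M: "M \<le> N"
    and large: "\<And>j. 1 \<le> j \<Longrightarrow> j \<le> M \<Longrightarrow> N \<le> c j + j"
    and drop: "\<And>j. 1 \<le> j \<Longrightarrow> j < M \<Longrightarrow> c j + j \<le> c (Suc j) + Suc j + 1"
    and "m \<le> M"
  shows "(\<exists>c' N'. has_cols ((nu ^^ m) \<gamma>) N' c' \<and> (m < M \<longrightarrow> N' \<le> c' 1 + 2) \<and>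
      (\<forall>j. 1 \<le> j \<longrightarrow> j \<le> N - m \<longrightarrow> c' j = c (j + m) + m)) \<and>
    psize ((nu ^^ m) \<gamma>) = psize \<gamma> + m \<and>
    dinv ((nu ^^ m) \<gamma>) = dinv \<gamma> + m \<and>
    (\<forall>n. (nu ^^ m) \<gamma> \<in> DP n \<longleftrightarrow> \<gamma> \<in> DP n \<and> (\<forall>j. 1 \<le> j \<longrightarrow> j \<le> m \<longrightarrow> c j + j < n))"
  using \<open>m \<le> M\<close>
proof (induction m)
  case 0
  then show ?case using cols N by (auto intro!: exI[of _ c] exI[of _ N])
next
  case (Suc m)
  then obtain c' N' where h: "has_cols ((nu ^^ m) \<gamma>) N' c'" "N' \<le> c' 1 + 2"
    and c': "\<And>j. 1 \<le> j \<Longrightarrow> j \<le> N - m \<Longrightarrow> c' j = c (j + m) + m" by auto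
  have c'1: "c' 1 = c (Suc m) + m" using c'[of 1] Suc M by simp
  let ?c = "\<lambda>j. if j \<le> c' 1 + 1 then c' (Suc j) + 1 else 0"
  have "?c j = c (j + Suc m) + Suc m" if "1 \<le> j" "j \<le> N - Suc m" for j
  proof -
    have "j \<le> c' 1 + 1" using large[of "Suc m"] that Suc.prems c'1 by simp
    then show ?thesis using c'[of "Suc j"] that by simp
  qed
  moreover have "c' 1 + 1 \<le> ?c 1 + 2" if "Suc m < M"
  proof -
    have "?c 1 = c (Suc (Suc m)) + Suc m" using calculation[of 1] that M by simp
    then show ?thesis using drop[of "Suc m"] that c'1 by simp
  qed
  moreover have "has_cols ((nu ^^ Suc m) \<gamma>) (c' 1 + 1) ?c" using nu_cols[OF h] by simp
  moreover have "psize ((nu ^^ Suc m) \<gamma>) = psize \<gamma> + Suc m" "dinv ((nu ^^ Suc m) \<gamma>) = dinv \<gamma> + Suc m"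
    using Suc psize_nu[OF h] dinv_nu[OF h] by auto
  moreover have "(nu ^^ Suc m) \<gamma> \<in> DP n \<longleftrightarrow>
      \<gamma> \<in> DP n \<and> (\<forall>j. 1 \<le> j \<longrightarrow> j \<le> Suc m \<longrightarrow> c j + j < n)" for n
    using Suc DP_nu[OF h, of n] c'1 by (auto simp: le_Suc_eq)
  ultimately show ?case by blast
qed

section \<open>Columns of the initial partitions\<close>

lemma part_padd: "part (padd \<alpha> \<beta>) i = part \<alpha> i + part \<beta> i"
proof -
  have "part (map f [1..<Suc N]) i = (if 1 \<le> i \<and> i \<le> N then f i else 0)" for f N
    by (auto simp: part_def simp del: upt_Suc)
  then show ?thesis by (cases "i = 0") (auto simp: padd_def part_def simp del: upt_Suc)
qed

lemma length_padd: "length (padd \<alpha> \<beta>) = max (length \<alpha>) (length \<beta>)"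
  by (simp add: padd_def del: upt_Suc)

lemma part_append: "part (\<alpha> @ \<beta>) i = (if i \<le> length \<alpha> then part \<alpha> i else part \<beta> (i - length \<alpha>))"
  by (auto simp: part_def nth_append)

lemma part_replicate: "part (replicate d x) i = (if 1 \<le> i \<and> i \<le> d then x else 0)"
  by (auto simp: part_def)

lemma length_II: "r < l \<Longrightarrow> length (II (K * l + r) l) = K + l"
  by (simp add: II_def length_padd)

lemma part_II:
  assumes "r < l"
  shows "part (II (K * l + r) l) i = (if i = 0 then 0 else if i \<le> 1 + K then l
    else if i \<le> K + l then l + 1 + K - i + (if i \<le> 1 + K + r then 1 else 0) else 0)"
proof -
  have "part (rev [1..<l]) i = (if 1 \<le> i \<and> i < l then l - i else 0)" for i
    by (auto simp: part_def rev_nth)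
  moreover have "(K * l + r) div l = K" "(K * l + r) mod l = r" using assms by auto
  ultimately show ?thesis using assms
    unfolding II_def part_padd part_append part_replicate length_replicate by auto
qed

text \<open>Equivalently, column \<open>j\<close> has level \<open>1 + K + l\<close>, raised by 1 in
  the last \<open>r\<close> columns. The later comparisons rest on these levels being almost
  constant.\<close>

definition II_col :: "nat \<Rightarrow> nat \<Rightarrow> nat \<Rightarrow> nat \<Rightarrow> nat" where
  "II_col l K r j = (if 1 \<le> j \<and> j \<le> l
     then 1 + K + l - j + (if l + 1 \<le> j + r then 1 else 0) else 0)"

lemma has_cols_II:
  assumes r: "r < l"
  shows "has_cols (II (K * l + r) l) l (II_col l K r)"
  unfolding has_cols_def
proof (intro conjI allI impI)
  show "is_partition (II (K * l + r) l)"
  proof (rule is_partitionI)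
    show "part (II (K * l + r) l) (Suc i) \<le> part (II (K * l + r) l) i" if "1 \<le> i" for i
      using that r by (auto simp: part_II[OF assms])
    show "0 < part (II (K * l + r) l) i" if "1 \<le> i" "i \<le> length (II (K * l + r) l)" for i
      using that assms unfolding part_II[OF assms] length_II[OF assms] by auto
  qed
  show "II_col l K r j = 0" if "l < j" for j using that by (simp add: II_col_def)
  show "j \<le> part (II (K * l + r) l) i \<longleftrightarrow> i \<le> II_col l K r j" if "1 \<le> i" "1 \<le> j" for i j
    using that r by (auto simp: part_II[OF assms] II_col_def)
qed

text \<open>\<open>II (p - 2) 1\<close> consists of \<open>p - 1\<close> parts equal to 1. Since
  \<open>p \<le> K\<close>, the first \<open>p - 1\<close> rows of \<open>II (K * i + r) i\<close>
  all have the maximal length \<open>i\<close>, so the sum attaches a new column of length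
  \<open>p - 1\<close>.\<close>

lemma has_cols_gam_small:
  assumes "2 \<le> p" "2 \<le> q" "i \<le> q - 1" and k: "(q - 1) * p = K * i + r" and r: "r < i" and K: "p \<le> K"
  shows "has_cols (gam p q i) (i + 1) (\<lambda>j. if j = i + 1 then p - 1 else II_col i K r j)"
proof -
  have g: "gam p q i = padd (II (K * i + r) i) (II (p - 2) 1)" using assms by (simp add: gam_def)
  have p1: "part (II (p - 2) 1) x = (if 1 \<le> x \<and> x \<le> p - 1 then 1 else 0)" for x
    using assms part_II[of 0 1 "p - 2" x] by auto
  have len: "length (gam p q i) = K + i"
    using assms length_II[of 0 1 "p - 2"] by (simp add: g length_padd length_II)
  have pp: "part (gam p q i) x = part (II (K * i + r) i) x + (if 1 \<le> x \<and> x \<le> p - 1 then 1 else 0)" for x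
    unfolding g part_padd p1 by simp
  show ?thesis unfolding has_cols_def
  proof (intro conjI allI impI)
    show "is_partition (gam p q i)"
    proof (rule is_partitionI)
      show "part (gam p q i) (Suc x) \<le> part (gam p q i) x" if "1 \<le> x" for x
        using that r K assms(1) unfolding pp part_II[OF r] by auto
      show "0 < part (gam p q i) x" if "1 \<le> x" "x \<le> length (gam p q i)" for x
        using that r unfolding len pp part_II[OF r] by auto
    qed
    show "(if j = i + 1 then p - 1 else II_col i K r j) = 0" if "i + 1 < j" for j
      using that by (simp add: II_col_def)
    show "j \<le> part (gam p q i) x \<longleftrightarrow> x \<le> (if j = i + 1 then p - 1 else II_col i K r j)"
      if "1 \<le> x" "1 \<le> j" for x j
      using that r K assms(1) unfolding pp part_II[OF r] II_col_def by auto
  qed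
qed

section \<open>Removing the \<open>q\<close>-th largest cell\<close>

lemma finite_diagram_cols:
  assumes "has_cols \<gamma> N c"
  shows "finite (diagram \<gamma>)"
proof (rule finite_subset)
  have "j \<le> N" if "1 \<le> i" "i \<le> c j" for i j
    using has_colsD(2)[OF assms, of j] that by (cases "N < j") auto
  then show "diagram \<gamma> \<subseteq> {..c 1} \<times> {..N}"
    using has_cols_antimono[OF assms, of 1] by (fastforce simp: has_cols_diagram[OF assms])
qed simp

text \<open>The number of larger cells strictly decreases along the total order
  \<open>cell_less\<close>, so it identifies a cell.\<close>

lemma u_cell_eqI:
  assumes fin: "finite (diagram \<gamma>)" and u: "u \<in> diagram \<gamma>" "card {d \<in> diagram \<gamma>. cell_less u d} = q - 1"
  shows "u_cell q \<gamma> = u"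
  unfolding u_cell_def
proof (rule the_equality)
  have lt: "card {d \<in> diagram \<gamma>. cell_less v d} < card {d \<in> diagram \<gamma>. cell_less w d}"
    if "cell_less w v" "v \<in> diagram \<gamma>" for v w
  proof (rule psubset_card_mono)
    have "cell_less w d" if "cell_less v d" for d
      using that \<open>cell_less w v\<close> by (auto simp: cell_less_def)
    moreover have "\<not> cell_less v v" by (auto simp: cell_less_def)
    ultimately show "{d \<in> diagram \<gamma>. cell_less v d} \<subset> {d \<in> diagram \<gamma>. cell_less w d}"
      using that by blast
  qed (use fin in auto)
  fix v assume v: "v \<in> diagram \<gamma> \<and> card {d \<in> diagram \<gamma>. cell_less v d} = q - 1"
  have "v = u \<or> cell_less u v \<or> cell_less v u"
    by (cases u; cases v) (auto simp: cell_less_def)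
  then show "v = u" using lt[of u v] lt[of v u] u v by auto
qed (use u in auto)

lemma has_cols_remove_cell:
  assumes cols: "has_cols \<gamma> N c" and e: "1 \<le> e" "c (Suc e) < c e"
  shows "has_cols (remove_cell \<gamma> (c e, e)) N (\<lambda>j. if j = e then c j - 1 else c j)"
proof -
  let ?c = "\<lambda>j. if j = e then c j - 1 else c j"
  obtain \<mu> where \<mu>: "has_cols \<mu> N ?c"
  proof -
    have "\<exists>\<mu>. has_cols \<mu> N ?c"
    proof (rule has_cols_exists)
      show "?c (Suc j) \<le> ?c j" if "1 \<le> j" for j
        using has_cols_antimono[OF cols that, of "Suc j"] e by auto
      show "?c j = 0" if "N < j" for j using has_colsD(2)[OF cols that] by (cases "j = e") simp_all
    qed
    then show ?thesis using that by blast
  qed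
  have d: "diagram \<mu> = diagram \<gamma> - {(c e, e)}"
    unfolding has_cols_diagram[OF \<mu>] has_cols_diagram[OF cols] using e by auto
  have "remove_cell \<gamma> (c e, e) = \<mu>"
    unfolding remove_cell_def
    by (rule the_equality) (use d has_colsD(1)[OF \<mu>] in \<open>auto intro: diagram_inject\<close>)
  with \<mu> show ?thesis by simp
qed

text \<open>For \<open>r = k mod l\<close>, the last diagonal meeting \<open>II k l\<close> consists of the bottom cells of its last \<open>r\<close>
  columns, and the diagonal before has one cell in each column. Hence the column of the \<open>q\<close>-th
  largest cell, for \<open>q < l\<close>:\<close>

definition u_col :: "nat \<Rightarrow> nat \<Rightarrow> nat \<Rightarrow> nat" where
  "u_col q r l = (if q \<le> r then l - r + q else q - r)"

lemma u_cell_II: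
  assumes "1 \<le> q" "q < l" and r: "r < l"
  shows "u_cell q (II (K * l + r) l) = (II_col l K r (u_col q r l), u_col q r l)"
proof (rule u_cell_eqI)
  let ?c = "II_col l K r" and ?e = "u_col q r l"
  note cols = has_cols_II[OF r, of K]
  show "finite (diagram (II (K * l + r) l))" using finite_diagram_cols[OF cols] .
  have e: "1 \<le> ?e" "?e \<le> l" using assms r by (auto simp: u_col_def)
  show "(?c ?e, ?e) \<in> diagram (II (K * l + r) l)"
    using e by (auto simp: has_cols_diagram[OF cols] II_col_def)
  \<comment> \<open>Columns of the larger cells. On one diagonal the order grows with the row, hence
    towards the left. For \<open>q \<le> r\<close> the larger cells are those of the last diagonal
    left of column \<open>?e\<close>; otherwise they are the whole last diagonal and the part of the
    preceding one left of \<open>?e\<close>. All are bottom cells.\<close>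
  let ?J = "if q \<le> r then {l + 1 - r..<?e} else {l + 1 - r..l} \<union> {1..<?e}"
  have "{d \<in> diagram (II (K * l + r) l). cell_less (?c ?e, ?e) d} = (\<lambda>j. (?c j, j)) ` ?J" (is "?L = ?R")
  proof (intro set_eqI iffI)
    fix d assume d: "d \<in> ?L"
    obtain i j where ij: "d = (i, j)" by force
    have 1: "1 \<le> i" "1 \<le> j" "i \<le> ?c j" using d ij by (auto simp: has_cols_diagram[OF cols])
    then have 2: "j \<le> l" by (auto simp: II_col_def split: if_splits)
    have "j \<in> ?J \<and> i = ?c j"
      using 1 2 d assms r e unfolding ij by (auto simp: cell_less_def II_col_def u_col_def split: if_splits)
    then show "d \<in> ?R" using ij by blast
  next
    fix d assume "d \<in> ?R"
    then obtain j where d: "d = (?c j, j)" and j: "j \<in> ?J" by blast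
    have 2: "1 \<le> j" "j \<le> l" using j r e by (auto split: if_splits)
    have "cell_less (?c ?e, ?e) (?c j, j)"
      using j 2 assms r e by (auto simp: cell_less_def II_col_def u_col_def split: if_splits)
    moreover have "1 \<le> ?c j" using 2 by (simp add: II_col_def)
    ultimately show "d \<in> ?L" using 2 by (simp add: d has_cols_diagram[OF cols])
  qed
  moreover have "inj_on (\<lambda>j. (?c j, j)) ?J" by (auto simp: inj_on_def)
  ultimately have "card ?L = card ?J" by (simp add: card_image)
  also have "\<dots> = q - 1"
  proof (cases "q \<le> r")
    case False
    then have "{l + 1 - r..l} \<inter> {1..<?e} = {}" using assms by (auto simp: u_col_def)
    then show ?thesis using False assms r by (simp add: card_Un_disjoint u_col_def)
  qed (use assms r in \<open>auto simp: u_col_def\<close>)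
  finally show "card ?L = q - 1" .
qed

lemma has_cols_gam_large:
  assumes "2 \<le> q" "q < l" and k: "q * (p - 1) = K * l + r" and r: "r < l"
  shows "has_cols (gam p q (l - 1)) l
    (\<lambda>j. if j = u_col q r l then II_col l K r j - 1 else II_col l K r j)"
proof -
  have "\<not> l - 1 \<le> q - 1" "l - 1 + 1 = l" using assms by auto
  then have g: "gam p q (l - 1) = remove_cell (II (K * l + r) l) (II_col l K r (u_col q r l), u_col q r l)"
    using assms u_cell_II[of q l r K] unfolding gam_def k by simp
  show ?thesis unfolding g
  proof (rule has_cols_remove_cell[OF has_cols_II[OF r]])
    \<comment> \<open>The removed cell must be a corner. For \<open>r > 0\<close> the columns
      \<open>l - r\<close> and \<open>l - r + 1\<close> have equal length, which is the only
      obstruction, and \<open>q < l\<close> keeps \<open>u_col q r l\<close> away from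
      \<open>l - r\<close>.\<close>
    show "1 \<le> u_col q r l" "II_col l K r (Suc (u_col q r l)) < II_col l K r (u_col q r l)"
      using assms(1,2) r by (auto simp: u_col_def II_col_def)
  qed
qed

section \<open>Statistics of the initial partitions\<close>

text \<open>The triangular number \<open>1 + ... + n\<close>, written as a binomial coefficient to
  match the term \<open>n choose 2\<close> of \<open>area\<close>.\<close>

definition tri :: "nat \<Rightarrow> nat" where
  "tri n = Suc n choose 2"

lemma tri_Suc: "tri (Suc n) = tri n + Suc n"
  by (simp add: tri_def numeral_2_eq_2)

lemma double_tri: "2 * tri n = n * (n + 1)"
  by (induction n) (auto simp: tri_Suc, simp add: tri_def)

lemma sum_countdown: "(\<Sum>j = 1..l. l - j) + l = tri l"
proof (induction l)
  case (Suc l)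
  have "(\<Sum>j = 1..Suc l. Suc l - j) = (\<Sum>j = 1..l. (l - j) + 1)" by (simp add: Suc_diff_le)
  also have "\<dots> = (\<Sum>j = 1..l. l - j) + l" by (subst sum.distrib) simp
  finally show ?case using Suc by (simp add: tri_Suc)
qed (simp add: tri_def)

text \<open>Split each column into the constant \<open>1 + K\<close>, a staircase and the
  \<open>r\<close> extra cells. Thus the size of \<open>II k l\<close> is
  \<open>tri l + k\<close>.\<close>

lemma sum_II_col:
  assumes "r < l"
  shows "(\<Sum>j = 1..l. II_col l K r j) = tri l + (K * l + r)"
proof -
  have "(\<Sum>j = 1..l. II_col l K r j) =
      (\<Sum>j = 1..l. (1 + K) + ((l - j) + (if j \<in> {l + 1 - r..l} then 1 else 0)))"
    by (rule sum.cong) (auto simp: II_col_def)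
  also have "\<dots> = l * (1 + K) + ((\<Sum>j = 1..l. l - j) + (\<Sum>j = 1..l. if j \<in> {l + 1 - r..l} then 1 else 0))"
    by (simp only: sum.distrib sum_constant card_atLeastAtMost) simp
  also have "(\<Sum>j = 1..l. if j \<in> {l + 1 - r..l} then 1 else 0) = card ({1..l} \<inter> {l + 1 - r..l})"
    by (subst sum.inter_restrict[symmetric]) auto
  also have "{1..l} \<inter> {l + 1 - r..l} = {l + 1 - r..l}" using assms by auto
  also have "card {l + 1 - r..l} = r" using assms by simp
  finally show ?thesis using sum_countdown[of l] by (simp add: algebra_simps)
qed

text \<open>Beyond \<open>N\<close> the level of an empty column is its own index. The two indices
  \<open>c j + j\<close> and \<open>c j + j + 1\<close> lie beyond \<open>N\<close> by
  \<open>deep\<close>, so each contributes one pair. These \<open>2 * N\<close> pairs minus the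
  \<open>N\<close> of \<open>dinv_cols\<close> leave the summand \<open>N\<close>.\<close>

lemma dinv_deep_cols:
  assumes cols: "has_cols \<gamma> N c" and deep: "\<And>j. 1 \<le> j \<Longrightarrow> j \<le> N \<Longrightarrow> N < c j + j"
  shows "dinv \<gamma> = N + (\<Sum>j = 1..N. card {j' \<in> {j<..N}. c j' + j' \<in> {c j + j, c j + j + 1}})"
proof -
  have "card {j'. j < j' \<and> c j' + j' \<in> {c j + j, c j + j + 1}} =
      card {j' \<in> {j<..N}. c j' + j' \<in> {c j + j, c j + j + 1}} + 2" if j: "j \<in> {1..N}" for j
  proof -
    have "{j'. j < j' \<and> c j' + j' \<in> {c j + j, c j + j + 1}} =
        {j' \<in> {j<..N}. c j' + j' \<in> {c j + j, c j + j + 1}} \<union> {c j + j, c j + j + 1}" (is "?L = ?R")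
    proof (rule set_eqI)
      fix x
      show "x \<in> ?L \<longleftrightarrow> x \<in> ?R"
        using deep[of j] j has_colsD(2)[OF cols, of x] by (cases "x \<le> N") auto
    qed
    moreover have "{j' \<in> {j<..N}. c j' + j' \<in> {c j + j, c j + j + 1}} \<inter> {c j + j, c j + j + 1} = {}"
      using deep[of j] j by auto
    ultimately show ?thesis by (simp add: card_Un_disjoint)
  qed
  then have "dinv \<gamma> + N =
      (\<Sum>j = 1..N. card {j' \<in> {j<..N}. c j' + j' \<in> {c j + j, c j + j + 1}} + 2)"
    unfolding dinv_cols[OF cols] by (rule sum.cong[OF refl])
  also have "\<dots> = (\<Sum>j = 1..N. card {j' \<in> {j<..N}. c j' + j' \<in> {c j + j, c j + j + 1}}) + 2 * N"
    by (simp only: sum.distrib sum_constant card_atLeastAtMost) simp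
  finally show ?thesis by simp
qed

lemma gam_small_stats:
  assumes "2 \<le> p" "2 \<le> q" "i \<le> q - 1" "(q - 1) * p = K * i + r" "r < i" "p \<le> K"
  shows "psize (gam p q i) + 1 = tri i + p * q" "dinv (gam p q i) = tri i + 1"
proof -
  let ?c = "\<lambda>j. if j = i + 1 then p - 1 else II_col i K r j"
  note cols = has_cols_gam_small[OF assms]
  have "psize (gam p q i) = (\<Sum>j = 1..i + 1. ?c j)" using psize_cols[OF cols] .
  also have "\<dots> = (\<Sum>j = 1..i. II_col i K r j) + (p - 1)" by simp
  also have "\<dots> = tri i + (q - 1) * p + (p - 1)" by (simp only: sum_II_col[OF assms(5)] assms(4))
  finally show "psize (gam p q i) + 1 = tri i + p * q"
    using assms(1,2) by (cases q) (auto simp: algebra_simps)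
  have lev: "?c j + j = (if j = i + 1 then p + i else 1 + K + i + (if i + 1 \<le> j + r then 1 else 0))"
    if "1 \<le> j" "j \<le> i + 1" for j
    using that assms(1) by (auto simp: II_col_def)
  have "dinv (gam p q i) =
      i + 1 + (\<Sum>j = 1..i + 1. card {j' \<in> {j<..i + 1}. ?c j' + j' \<in> {?c j + j, ?c j + j + 1}})"
  proof (rule dinv_deep_cols[OF cols])
    show "i + 1 < ?c j + j" if "1 \<le> j" "j \<le> i + 1" for j
      using lev[OF that] assms(1,6) by auto
  qed
  also have "(\<Sum>j = 1..i + 1. card {j' \<in> {j<..i + 1}. ?c j' + j' \<in> {?c j + j, ?c j + j + 1}}) =
      (\<Sum>j = 1..i + 1. i - j)"
  proof (rule sum.cong[OF refl])
    fix j assume j: "j \<in> {1..i + 1}"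
    \<comment> \<open>The levels of the first \<open>i\<close> columns increase weakly and differ by
      at most 1, so all their pairs count. The attached column has the lower level
      \<open>p + i\<close> and is paired with none of them.\<close>
    have "?c j' + j' \<in> {?c j + j, ?c j + j + 1} \<longleftrightarrow> j' \<le> i" if "j' \<in> {j<..i + 1}" for j'
      using lev[of j] lev[of j'] that j assms(6) by auto
    then have "{j' \<in> {j<..i + 1}. ?c j' + j' \<in> {?c j + j, ?c j + j + 1}} = {j<..i}" by fastforce
    then show "card {j' \<in> {j<..i + 1}. ?c j' + j' \<in> {?c j + j, ?c j + j + 1}} = i - j" by simp
  qed
  also have "(\<Sum>j = 1..i + 1. i - j) = (\<Sum>j = 1..i. i - j)" by simp
  finally show "dinv (gam p q i) = tri i + 1" using sum_countdown[of i] by simp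
qed

lemma gam_large_level:
  assumes "2 \<le> p" "2 \<le> q" "q < l" "q * (p - 1) = K * l + r" "r < l" "1 \<le> j" "j \<le> l"
  shows "(if j = u_col q r l then II_col l K r j - 1 else II_col l K r j) + j =
      K + l + (if l + 1 \<le> j + r then 1 else 0) + (if j = u_col q r l then 0 else 1)"
    and "l < (if j = u_col q r l then II_col l K r j - 1 else II_col l K r j) + j"
proof -
  let ?c = "(if j = u_col q r l then II_col l K r j - 1 else II_col l K r j)"
  show lev: "?c + j = K + l + (if l + 1 \<le> j + r then 1 else 0) + (if j = u_col q r l then 0 else 1)"
    using assms(6,7) by (auto simp: II_col_def)
  \<comment> \<open>Only column \<open>u_col q r l\<close> could have a level as low as
    \<open>l\<close>, namely if \<open>K = 0\<close>. But then \<open>r = q * (p - 1)\<close>, hence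
    \<open>q \<le> r\<close> and that column is among the last \<open>r\<close>, where the level is
    one higher.\<close>
  have "q * 1 \<le> q * (p - 1)" using assms(1) by (intro mult_left_mono) auto
  then have "q \<le> K * l + r" unfolding assms(4) by simp
  then have "q \<le> r" if "K = 0" using that by simp
  then have "l + 1 \<le> j + r" if "K = 0" "j = u_col q r l"
    using that assms(2,3,5) by (auto simp: u_col_def)
  then show "l < ?c + j" unfolding lev by auto
qed

lemma gam_large_stats:
  assumes "2 \<le> p" "2 \<le> q" "q < l" "q * (p - 1) = K * l + r" "r < l"
  shows "psize (gam p q (l - 1)) + 1 + q = tri l + p * q" "dinv (gam p q (l - 1)) + q = tri l + 1"
proof -
  let ?e = "u_col q r l"
  let ?c = "\<lambda>j. if j = ?e then II_col l K r j - 1 else II_col l K r j"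
  note cols = has_cols_gam_large[OF assms(2-5)]
  have e: "?e \<in> {1..l}" using assms by (auto simp: u_col_def)
  have "psize (gam p q (l - 1)) + 1 = (\<Sum>j = 1..l. ?c j) + 1" using psize_cols[OF cols] by simp
  also have "\<dots> = II_col l K r ?e + (\<Sum>j \<in> {1..l} - {?e}. ?c j)"
    using e by (subst sum.remove[of _ ?e]) (auto simp: II_col_def)
  also have "\<dots> = II_col l K r ?e + (\<Sum>j \<in> {1..l} - {?e}. II_col l K r j)" by simp
  also have "\<dots> = (\<Sum>j = 1..l. II_col l K r j)" using e by (subst sum.remove[of _ ?e]) auto
  also have "\<dots> = tri l + q * (p - 1)" by (simp only: sum_II_col[OF assms(5)] assms(4))
  finally show "psize (gam p q (l - 1)) + 1 + q = tri l + p * q"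
    using assms(1) by (cases p) (auto simp: algebra_simps)
  note lev = gam_large_level(1)[OF assms]
  \<comment> \<open>The later columns not paired with column \<open>j\<close>. If
    \<open>q \<le> r\<close>, the lowered column \<open>?e\<close> is among the last
    \<open>r\<close> and falls 1 below the level of the others, so it is lost for those to its left.
    Otherwise it falls 1 below every column to its left and 2 below the last \<open>r\<close>
    columns. Either way \<open>q - 1\<close> pairs are lost.\<close>
  define lost where "lost j =
    (if q \<le> r then if l + 1 \<le> j + r \<and> j < ?e then {?e} else {}
     else if j < ?e then {?e} else if j = ?e then {l + 1 - r..l} else {})" for j
  have "card {j' \<in> {j<..l}. ?c j' + j' \<in> {?c j + j, ?c j + j + 1}} + card (lost j) = l - j"
    if j: "j \<in> {1..l}" for j
  proof -
    have sub: "lost j \<subseteq> {j<..l}" using e j assms(2,3,5) by (auto simp: lost_def u_col_def)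
    have "?c j' + j' \<in> {?c j + j, ?c j + j + 1} \<longleftrightarrow> j' \<notin> lost j" if "j' \<in> {j<..l}" for j'
    proof -
      have j': "1 \<le> j" "j < j'" "j' \<le> l" using j that by auto
      obtain e where e: "?e = e" "if q \<le> r then e = l - r + q else e = q - r"
        by (auto simp: u_col_def)
      have 1: "?c j + j = K + l + (if l + 1 \<le> j + r then 1 else 0) + (if j = e then 0 else 1)"
        "?c j' + j' = K + l + (if l + 1 \<le> j' + r then 1 else 0) + (if j' = e then 0 else 1)"
        using lev[of j] lev[of j'] j' unfolding e(1) by auto
      show ?thesis unfolding 1 unfolding lost_def e(1) using j' e(2) assms(2,3,5)
        by (cases "q \<le> r"; cases "j = e"; cases "j' = e") auto
    qed
    then have "{j' \<in> {j<..l}. ?c j' + j' \<in> {?c j + j, ?c j + j + 1}} = {j<..l} - lost j" by blast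
    then show ?thesis using sub card_mono[OF _ sub] by (simp add: card_Diff_subset finite_subset[OF sub])
  qed
  then have "(\<Sum>j = 1..l. card {j' \<in> {j<..l}. ?c j' + j' \<in> {?c j + j, ?c j + j + 1}}) +
      (\<Sum>j = 1..l. card (lost j)) = (\<Sum>j = 1..l. l - j)"
    unfolding sum.distrib[symmetric] by (rule sum.cong[OF refl])
  moreover have "(\<Sum>j = 1..l. card (lost j)) = q - 1"
  proof (cases "q \<le> r")
    case True
    then have "(\<Sum>j = 1..l. card (lost j)) = (\<Sum>j = 1..l. if j \<in> {l + 1 - r..<?e} then 1 else 0)"
      by (intro sum.cong) (auto simp: lost_def)
    also have "\<dots> = card ({1..l} \<inter> {l + 1 - r..<?e})"
      by (subst sum.inter_restrict[symmetric]) auto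
    also have "{1..l} \<inter> {l + 1 - r..<?e} = {l + 1 - r..<?e}" using e assms(5) by auto
    finally show ?thesis using True assms(3,5) by (simp add: u_col_def)
  next
    case False
    then have "(\<Sum>j = 1..l. card (lost j)) =
        (\<Sum>j = 1..l. (if j \<in> {1..<?e} then 1 else 0) + (if j = ?e then r else 0))"
      using assms(5) by (intro sum.cong) (auto simp: lost_def)
    also have "\<dots> = card ({1..l} \<inter> {1..<?e}) + r"
      unfolding sum.distrib using e by (subst sum.inter_restrict[symmetric]) auto
    also have "{1..l} \<inter> {1..<?e} = {1..<?e}" using e by auto
    finally show ?thesis using False by (simp add: u_col_def)
  qed
  moreover have "dinv (gam p q (l - 1)) =
      l + (\<Sum>j = 1..l. card {j' \<in> {j<..l}. ?c j' + j' \<in> {?c j + j, ?c j + j + 1}})"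
    by (rule dinv_deep_cols[OF cols gam_large_level(2)[OF assms]])
  ultimately show "dinv (gam p q (l - 1)) + q = tri l + 1"
    using sum_countdown[of l] assms(2) by simp
qed

section \<open>Membership in \<open>DP n\<close> along a chain as a single inequality\<close>

lemma mult_add_le_mult_iff:
  fixes L x y s :: int
  assumes "0 < s" "s \<le> L"
  shows "L * x + s \<le> L * y \<longleftrightarrow> x + 1 \<le> y"
proof
  assume "x + 1 \<le> y"
  then have "L * (x + 1) \<le> L * y" using assms by (intro mult_left_mono) auto
  then show "L * x + s \<le> L * y" using assms by (simp add: algebra_simps)
next
  assume "L * x + s \<le> L * y"
  then have "L * x < L * y" using assms by linarith
  then show "x + 1 \<le> y" using assms by (simp add: mult_less_cancel_left)
qed

text \<open>The highest level is first reached at column \<open>j0\<close>, so it only matters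
  whether \<open>m\<close> reaches \<open>j0\<close>. With \<open>x = n - l - 1\<close> the
  condition says that \<open>K\<close> plus the ceiling of \<open>(r + m) / l\<close> is at most
  \<open>x\<close>; multiplying by \<open>l\<close> gives the inequality. Asking only for upper
  bounds and for the exact value at \<open>j0\<close> leaves room for the column shortened by
  removing a cell.\<close>

lemma levels_le_iff:
  fixes a :: "nat \<Rightarrow> nat" and K r l m n :: nat
  assumes r: "r < l" and m: "m \<le> l"
    and le: "\<And>j. 1 \<le> j \<Longrightarrow> j \<le> l \<Longrightarrow> a j \<le> 1 + K + l + (if l + 1 \<le> j + r then 1 else 0)"
    and eq: "a (if r = 0 then 1 else l + 1 - r) = 1 + K + l + (if r = 0 then 0 else 1)"
  shows "(\<forall>j. 1 \<le> j \<longrightarrow> j \<le> l \<longrightarrow> a j \<le> n) \<and> (\<forall>j. 1 \<le> j \<longrightarrow> j \<le> m \<longrightarrow> a j < n) \<longleftrightarrow>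
    int (K * l + r) + int m \<le> int l * (int n - int l - 1)" (is "?L \<longleftrightarrow> ?R")
proof -
  define x where "x = int n - int l - 1"
  define j0 where "j0 = (if r = 0 then 1 else l + 1 - r)"
  define d :: nat where "d = (if r = 0 then 0 else 1)"
  have j0: "1 \<le> j0" "j0 \<le> l" and a0: "a j0 = 1 + K + l + d" using r eq by (auto simp: j0_def d_def)
  have bd: "a j \<le> 1 + K + l + (if j0 \<le> j then d else 0)" if "1 \<le> j" "j \<le> l" for j
    using le[OF that] r that by (auto simp: j0_def d_def split: if_splits)
  have "?L \<longleftrightarrow> 1 + K + l + d \<le> n \<and> (j0 \<le> m \<longrightarrow> 1 + K + l + d < n)"
  proof
    assume ?L
    then show "1 + K + l + d \<le> n \<and> (j0 \<le> m \<longrightarrow> 1 + K + l + d < n)" using j0 a0 by auto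
  next
    assume R: "1 + K + l + d \<le> n \<and> (j0 \<le> m \<longrightarrow> 1 + K + l + d < n)"
    have "a j \<le> n" if "1 \<le> j" "j \<le> l" for j using bd[OF that] R by (auto split: if_splits)
    moreover have "a j < n" if "1 \<le> j" "j \<le> m" for j
    proof (cases "j0 \<le> j")
      case True
      then show ?thesis using bd[of j] R that m by auto
    next
      case False
      then have "r \<noteq> 0" using that by (auto simp: j0_def split: if_splits)
      then show ?thesis using bd[of j] R that m False by (auto simp: d_def)
    qed
    ultimately show ?L by blast
  qed
  also have "\<dots> \<longleftrightarrow> int K + int d \<le> x \<and> (j0 \<le> m \<longrightarrow> int K + int d + 1 \<le> x)"
    by (auto simp: x_def)
  also have "\<dots> \<longleftrightarrow> int l * int K + (int r + int m) \<le> int l * x"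
  proof -
    consider "r + m = 0" | "0 < r + m" "r + m \<le> l" | "l < r + m" by linarith
    then show ?thesis
    proof cases
      case 1
      then show ?thesis using r by (simp add: j0_def d_def)
    next
      case 2
      then show ?thesis using mult_add_le_mult_iff[of "int r + int m" "int l" "int K" x] r
        by (auto simp: j0_def d_def)
    next
      case 3
      have "int l * int K + (int r + int m) = int l * (int K + 1) + (int r + int m - int l)"
        by (simp add: algebra_simps)
      then show ?thesis
        using mult_add_le_mult_iff[of "int r + int m - int l" "int l" "int K + 1" x] r m 3
        by (auto simp: j0_def d_def)
    qed
  qed
  finally show ?thesis by (simp add: x_def algebra_simps)
qed

lemma DP_cols_upto:
  assumes "has_cols \<gamma> N c" "\<And>j. 1 \<le> j \<Longrightarrow> j \<le> N \<Longrightarrow> 1 \<le> c j"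
  shows "\<gamma> \<in> DP n \<longleftrightarrow> (\<forall>j. 1 \<le> j \<longrightarrow> j \<le> N \<longrightarrow> c j + j \<le> n)"
proof -
  have "j \<le> N" if "1 \<le> c j" for j using that has_colsD(2)[OF assms(1), of j] by (cases "N < j") auto
  then show ?thesis using assms(2) unfolding DP_cols[OF assms(1)] by blast
qed

section \<open>Statistics along the chains\<close>

lemma nu_gam_small:
  assumes "2 \<le> p" "1 \<le> i" "i + 2 \<le> q" "m \<le> i"
  shows "dinv ((nu ^^ m) (gam p q i)) = tri i + 1 + m"
    and "psize ((nu ^^ m) (gam p q i)) + 1 = tri i + p * q + m"
    and "(nu ^^ m) (gam p q i) \<in> DP n \<longleftrightarrow>
      int ((q - 1) * p) + int m \<le> int i * (int n - int i - 1)"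
proof -
  have q: "2 \<le> q" "i \<le> q - 1" using assms by auto
  obtain K r where k: "(q - 1) * p = K * i + r" and r: "r < i"
    using div_mult_mod_eq[of "(q - 1) * p" i] mod_less_divisor[of i "(q - 1) * p"] assms(2)
    by (metis less_le_trans zero_less_one)
  have K: "p \<le> K"
  proof (rule ccontr)
    assume "\<not> p \<le> K"
    then have "(K + 1) * i \<le> p * (q - 1)" using q by (intro mult_le_mono) auto
    then show False using k r by (simp add: algebra_simps)
  qed
  define c where "c j = (if j = i + 1 then p - 1 else II_col i K r j)" for j
  have cols: "has_cols (gam p q i) (i + 1) c"
    using has_cols_gam_small[OF assms(1) q k r K] by (simp add: c_def[abs_def])
  have lev: "c j + j = 1 + K + i + (if i + 1 \<le> j + r then 1 else 0)" if "1 \<le> j" "j \<le> i" for j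
    using that by (auto simp: c_def II_col_def)
  have ci: "c (i + 1) = p - 1" by (simp add: c_def)
  have it: "psize ((nu ^^ m) (gam p q i)) = psize (gam p q i) + m \<and>
    dinv ((nu ^^ m) (gam p q i)) = dinv (gam p q i) + m \<and>
    (\<forall>n. (nu ^^ m) (gam p q i) \<in> DP n \<longleftrightarrow>
      gam p q i \<in> DP n \<and> (\<forall>j. 1 \<le> j \<longrightarrow> j \<le> m \<longrightarrow> c j + j < n))"
  proof (rule nu_iterate[OF cols _ _ _ _ assms(4), THEN conjunct2])
    show "i + 1 \<le> c 1 + 2" using lev[of 1] assms(2) by simp
    show "i + 1 \<le> c j + j" if "1 \<le> j" "j \<le> i" for j using lev[OF that] by simp
    show "c j + j \<le> c (Suc j) + Suc j + 1" if "1 \<le> j" "j < i" for j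
      using lev[of j] lev[of "Suc j"] that by auto
  qed simp
  note st = gam_small_stats[OF assms(1) q k r K]
  show "dinv ((nu ^^ m) (gam p q i)) = tri i + 1 + m"
    "psize ((nu ^^ m) (gam p q i)) + 1 = tri i + p * q + m" using it st by auto
  have pos: "1 \<le> c j" if "1 \<le> j" "j \<le> i + 1" for j
    using that assms(1) by (auto simp: c_def II_col_def)
  have "(nu ^^ m) (gam p q i) \<in> DP n \<longleftrightarrow> (\<forall>j. 1 \<le> j \<longrightarrow> j \<le> i + 1 \<longrightarrow> c j + j \<le> n) \<and>
      (\<forall>j. 1 \<le> j \<longrightarrow> j \<le> m \<longrightarrow> c j + j < n)"
    using it DP_cols_upto[OF cols pos, of n] by auto
  \<comment> \<open>The attached column has level \<open>p + i\<close>, below that of column 1, so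
    its condition follows from that of column 1.\<close>
  also have "(\<forall>j. 1 \<le> j \<longrightarrow> j \<le> i + 1 \<longrightarrow> c j + j \<le> n) \<longleftrightarrow> (\<forall>j. 1 \<le> j \<longrightarrow> j \<le> i \<longrightarrow> c j + j \<le> n)"
  proof (intro iffI allI impI)
    fix j assume h: "\<forall>j. 1 \<le> j \<longrightarrow> j \<le> i \<longrightarrow> c j + j \<le> n" and j: "1 \<le> j" "j \<le> i + 1"
    have "1 + K + i \<le> n" using h[rule_format, of 1] lev[of 1] assms(2) by simp
    then have "c (i + 1) + (i + 1) \<le> n" unfolding ci using K assms(1) by simp
    then show "c j + j \<le> n" using h j by (cases "j = i + 1") auto
  qed auto
  also have "\<dots> \<and> (\<forall>j. 1 \<le> j \<longrightarrow> j \<le> m \<longrightarrow> c j + j < n) \<longleftrightarrow>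
      int (K * i + r) + int m \<le> int i * (int n - int i - 1)"
  proof (rule levels_le_iff[OF r assms(4)])
    let ?j = "if r = 0 then 1 else i + 1 - r"
    show "c ?j + ?j = 1 + K + i + (if r = 0 then 0 else 1)"
      using lev[of ?j] r by (auto split: if_splits)
  qed (use lev in auto)
  finally show "(nu ^^ m) (gam p q i) \<in> DP n \<longleftrightarrow>
      int ((q - 1) * p) + int m \<le> int i * (int n - int i - 1)" unfolding k .
qed

text \<open>For \<open>i = q - 1\<close> the quotient is exactly \<open>p\<close> with remainder 0,
  so the attached column is only 1 below the common level \<open>p + q\<close> of the others. This
  permits one more application of \<open>nu\<close> than for smaller \<open>i\<close>. Since
  \<open>tri q = tri (q - 1) + q\<close>, the formulas take the shape they have for
  \<open>l > q\<close>, at \<open>l = q\<close>.\<close>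

lemma nu_gam_mid:
  assumes "2 \<le> p" "2 \<le> q" "m \<le> q"
  shows "dinv ((nu ^^ m) (gam p q (q - 1))) + q = tri q + 1 + m"
    and "psize ((nu ^^ m) (gam p q (q - 1))) + 1 + q = tri q + p * q + m"
    and "(nu ^^ m) (gam p q (q - 1)) \<in> DP n \<longleftrightarrow>
      int (q * (p - 1)) + int m \<le> int q * (int n - int q - 1)"
proof -
  define i where "i = q - 1"
  have i: "1 \<le> i" "q = i + 1" using assms by (auto simp: i_def)
  have k: "(q - 1) * p = p * i + 0" and le: "i \<le> q - 1" and r: "0 < i"
    using i by (auto simp: mult.commute)
  define c where "c j = (if j = i + 1 then p - 1 else II_col i p 0 j)" for j
  have cols: "has_cols (gam p q i) q c"
    using has_cols_gam_small[OF assms(1,2) le k r] i by (simp add: c_def[abs_def])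
  have lev: "c j + j = (if j = q then p + q - 1 else p + q)" if "1 \<le> j" "j \<le> q" for j
    using that i assms(1) by (auto simp: c_def II_col_def)
  have it: "psize ((nu ^^ m) (gam p q i)) = psize (gam p q i) + m \<and>
    dinv ((nu ^^ m) (gam p q i)) = dinv (gam p q i) + m \<and>
    (\<forall>n. (nu ^^ m) (gam p q i) \<in> DP n \<longleftrightarrow>
      gam p q i \<in> DP n \<and> (\<forall>j. 1 \<le> j \<longrightarrow> j \<le> m \<longrightarrow> c j + j < n))"
  proof (rule nu_iterate[OF cols _ _ _ _ assms(3), THEN conjunct2])
    show "q \<le> c 1 + 2" using lev[of 1] assms by (simp split: if_splits)
    show "q \<le> c j + j" if "1 \<le> j" "j \<le> q" for j using lev[OF that] assms(1) by auto
    show "c j + j \<le> c (Suc j) + Suc j + 1" if "1 \<le> j" "j < q" for j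
      using lev[of j] lev[of "Suc j"] that by auto
  qed simp
  note st = gam_small_stats[OF assms(1,2) le k r order_refl]
  have tq: "tri q = tri i + q" using tri_Suc[of i] i by simp
  show "dinv ((nu ^^ m) (gam p q (q - 1))) + q = tri q + 1 + m"
    "psize ((nu ^^ m) (gam p q (q - 1))) + 1 + q = tri q + p * q + m"
    using it st tq unfolding i_def[symmetric] by auto
  have pos: "1 \<le> c j" if "1 \<le> j" "j \<le> q" for j
    using that i assms(1) by (auto simp: c_def II_col_def)
  have "(nu ^^ m) (gam p q i) \<in> DP n \<longleftrightarrow> (\<forall>j. 1 \<le> j \<longrightarrow> j \<le> q \<longrightarrow> c j + j \<le> n) \<and>
      (\<forall>j. 1 \<le> j \<longrightarrow> j \<le> m \<longrightarrow> c j + j < n)"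
    using it DP_cols_upto[OF cols pos, of n] by auto
  also have "\<dots> \<longleftrightarrow> p + q \<le> n \<and> (1 \<le> m \<longrightarrow> p + q < n)"
  proof
    assume h: "(\<forall>j. 1 \<le> j \<longrightarrow> j \<le> q \<longrightarrow> c j + j \<le> n) \<and> (\<forall>j. 1 \<le> j \<longrightarrow> j \<le> m \<longrightarrow> c j + j < n)"
    show "p + q \<le> n \<and> (1 \<le> m \<longrightarrow> p + q < n)"
      using h[THEN conjunct1, rule_format, of 1] h[THEN conjunct2, rule_format, of 1] lev[of 1] assms(2)
      by auto
  qed (use lev assms(3) in auto)
  also have "\<dots> \<longleftrightarrow> int q * (int p - 1) + int m \<le> int q * (int n - int q - 1)"
  proof (cases "m = 0")
    case True
    then show ?thesis using assms by auto
  next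
    case False
    then show ?thesis
      using mult_add_le_mult_iff[of "int m" "int q" "int p - 1" "int n - int q - 1"] assms by auto
  qed
  finally show "(nu ^^ m) (gam p q (q - 1)) \<in> DP n \<longleftrightarrow>
      int (q * (p - 1)) + int m \<le> int q * (int n - int q - 1)"
    using assms(1) by (simp add: i_def of_nat_diff)
qed

lemma nu_gam_large:
  assumes "2 \<le> p" "2 \<le> q" "q < l" "m \<le> l"
  shows "dinv ((nu ^^ m) (gam p q (l - 1))) + q = tri l + 1 + m"
    and "psize ((nu ^^ m) (gam p q (l - 1))) + 1 + q = tri l + p * q + m"
    and "(nu ^^ m) (gam p q (l - 1)) \<in> DP n \<longleftrightarrow>
      int (q * (p - 1)) + int m \<le> int l * (int n - int l - 1)"
proof -
  obtain K r where k: "q * (p - 1) = K * l + r" and r: "r < l"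
    using div_mult_mod_eq[of "q * (p - 1)" l] mod_less_divisor[of l "q * (p - 1)"] assms(3)
    by (metis gr_implies_not0 gr0I)
  define e where "e = u_col q r l"
  define c where "c j = (if j = e then II_col l K r j - 1 else II_col l K r j)" for j
  have cols: "has_cols (gam p q (l - 1)) l c"
    using has_cols_gam_large[OF assms(2,3) k r] by (simp add: c_def[abs_def] e_def)
  have lev: "c j + j = K + l + (if l + 1 \<le> j + r then 1 else 0) + (if j = e then 0 else 1)"
    and deep: "l < c j + j" if "1 \<le> j" "j \<le> l" for j
    using gam_large_level[OF assms(1-3) k r that] by (simp_all add: c_def e_def)
  have it: "psize ((nu ^^ m) (gam p q (l - 1))) = psize (gam p q (l - 1)) + m \<and>
    dinv ((nu ^^ m) (gam p q (l - 1))) = dinv (gam p q (l - 1)) + m \<and>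
    (\<forall>n. (nu ^^ m) (gam p q (l - 1)) \<in> DP n \<longleftrightarrow>
      gam p q (l - 1) \<in> DP n \<and> (\<forall>j. 1 \<le> j \<longrightarrow> j \<le> m \<longrightarrow> c j + j < n))"
  proof (rule nu_iterate[OF cols _ _ _ _ assms(4), THEN conjunct2])
    show "l \<le> c 1 + 2" using deep[of 1] assms by simp
    show "l \<le> c j + j" if "1 \<le> j" "j \<le> l" for j using deep[OF that] by simp
    show "c j + j \<le> c (Suc j) + Suc j + 1" if "1 \<le> j" "j < l" for j
      using lev[of j] lev[of "Suc j"] that by auto
  qed simp
  note st = gam_large_stats[OF assms(1-3) k r]
  show "dinv ((nu ^^ m) (gam p q (l - 1))) + q = tri l + 1 + m"
    "psize ((nu ^^ m) (gam p q (l - 1))) + 1 + q = tri l + p * q + m"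
    using it st by auto
  have pos: "1 \<le> c j" if "1 \<le> j" "j \<le> l" for j using deep[OF that] that by simp
  have "(nu ^^ m) (gam p q (l - 1)) \<in> DP n \<longleftrightarrow> (\<forall>j. 1 \<le> j \<longrightarrow> j \<le> l \<longrightarrow> c j + j \<le> n) \<and>
      (\<forall>j. 1 \<le> j \<longrightarrow> j \<le> m \<longrightarrow> c j + j < n)"
    using it DP_cols_upto[OF cols pos, of n] by auto
  also have "\<dots> \<longleftrightarrow> int (K * l + r) + int m \<le> int l * (int n - int l - 1)"
  proof (rule levels_le_iff[OF r assms(4)])
    show "c j + j \<le> 1 + K + l + (if l + 1 \<le> j + r then 1 else 0)" if "1 \<le> j" "j \<le> l" for j
      using lev[OF that] by auto
    let ?j = "if r = 0 then 1 else l + 1 - r"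
    \<comment> \<open>The first column of highest level is not the shortened one. If
      \<open>r = 0\<close>, then \<open>e = q\<close>, which is at least 2; otherwise
      \<open>e\<close> is either left of the last \<open>r\<close> columns or the
      \<open>q\<close>-th of them.\<close>
    have "?j \<noteq> e" using assms(2,3) r by (auto simp: e_def u_col_def)
    then show "c ?j + ?j = 1 + K + l + (if r = 0 then 0 else 1)"
      using lev[of ?j] r by (auto split: if_splits)
  qed
  finally show "(nu ^^ m) (gam p q (l - 1)) \<in> DP n \<longleftrightarrow>
      int (q * (p - 1)) + int m \<le> int l * (int n - int l - 1)" unfolding k .
qed

lemma nu_gam_high:
  assumes "2 \<le> p" "2 \<le> q" "q \<le> l" "m \<le> l"
  shows "dinv ((nu ^^ m) (gam p q (l - 1))) + q = tri l + 1 + m"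
    and "psize ((nu ^^ m) (gam p q (l - 1))) + 1 + q = tri l + p * q + m"
    and "(nu ^^ m) (gam p q (l - 1)) \<in> DP n \<longleftrightarrow>
      int (q * (p - 1)) + int m \<le> int l * (int n - int l - 1)"
  using nu_gam_mid[of p q m] nu_gam_large[of p q l m] assms by (cases "q = l"; auto)+

section \<open>The whole family: size and distinct values of \<open>dinv\<close>\<close>

lemma DD_cases:
  assumes "2 \<le> q" "\<gamma> \<in> DD p q"
  obtains (low) i m where "1 \<le> i" "i + 2 \<le> q" "m \<le> i" "\<gamma> = (nu ^^ m) (gam p q i)"
  | (high) l m where "q \<le> l" "m \<le> l" "\<gamma> = (nu ^^ m) (gam p q (l - 1))"
proof -
  obtain i where i: "1 \<le> i" "\<gamma> \<in> RR p q i" using assms(2) by (auto simp: DD_def)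
  show ?thesis
  proof (cases "i \<le> q - 2")
    case True
    then obtain m where "m \<le> i" "\<gamma> = (nu ^^ m) (gam p q i)" using i by (auto simp: RR_def)
    then show ?thesis using True i assms(1) by (intro low[of i m]) auto
  next
    case False
    then obtain m where "m \<le> i + 1" "\<gamma> = (nu ^^ m) (gam p q i)" using i by (auto simp: RR_def)
    then show ?thesis using False by (intro high[of "i + 1" m]) auto
  qed
qed

lemma low_in_DD: "1 \<le> i \<Longrightarrow> i + 2 \<le> q \<Longrightarrow> m \<le> i \<Longrightarrow> (nu ^^ m) (gam p q i) \<in> DD p q"
  unfolding DD_def RR_def by (intro UN_I[of i]) auto

lemma high_in_DD: "2 \<le> q \<Longrightarrow> q \<le> l \<Longrightarrow> m \<le> l \<Longrightarrow> (nu ^^ m) (gam p q (l - 1)) \<in> DD p q"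
  unfolding DD_def RR_def by (intro UN_I[of "l - 1"]) auto

lemma psize_DD:
  assumes "2 \<le> p" "2 \<le> q" "\<gamma> \<in> DD p q"
  shows "psize \<gamma> + 2 = dinv \<gamma> + p * q"
  using assms(2,3)
proof (cases rule: DD_cases)
  case (low i m)
  then show ?thesis using nu_gam_small[of p i q m] assms(1) by simp
next
  case (high l m)
  then show ?thesis using nu_gam_high[of p q l m] assms(1,2) by simp
qed

lemma tri_mono: "m \<le> n \<Longrightarrow> tri m \<le> tri n"
  by (induction rule: dec_induct) (auto simp: tri_Suc)

text \<open>The block of \<open>l\<close> runs from \<open>tri l + 1\<close> to
  \<open>tri (Suc l)\<close>, so consecutive blocks are adjacent and disjoint.\<close>

lemma tri_block_unique:
  assumes "tri l + 1 + m = tri l' + 1 + m'" "m \<le> l" "m' \<le> l'"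
  shows "l = l' \<and> m = m'"
proof (rule ccontr)
  assume "\<not> ?thesis"
  then consider "l < l'" | "l' < l" using assms by force
  then show False
    using assms tri_mono[of "Suc l" l'] tri_mono[of "Suc l'" l] by cases (auto simp: tri_Suc)
qed

lemma inj_on_dinv_DD:
  assumes "2 \<le> p" "2 \<le> q"
  shows "inj_on dinv (DD p q)"
proof (rule inj_onI)
  \<comment> \<open>The low blocks end at \<open>tri (q - 1)\<close> at the latest. The high ones
    are shifted down by \<open>q\<close> and begin at
    \<open>tri q + 1 - q = tri (q - 1) + 1\<close>.\<close>
  have low_high: "dinv \<gamma> < dinv \<delta>"
    if "1 \<le> i" "i + 2 \<le> q" "m \<le> i" "\<gamma> = (nu ^^ m) (gam p q i)"
      "q \<le> l" "m' \<le> l" "\<delta> = (nu ^^ m') (gam p q (l - 1))" for \<gamma> \<delta> i m l m'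
  proof -
    define q' where "q' = q - 1"
    have q': "q = Suc q'" "Suc i \<le> q'" using that(2) by (auto simp: q'_def)
    have "dinv \<gamma> < tri (Suc i) + 1" using nu_gam_small(1)[of p i q m] that assms(1) by (simp add: tri_Suc)
    also have "\<dots> \<le> tri q' + 1" using tri_mono[OF q'(2)] by simp
    also have "\<dots> \<le> dinv \<delta>"
      using nu_gam_high(1)[of p q l m'] tri_mono[OF that(5)] that assms tri_Suc[of q'] q'(1) by simp
    finally show ?thesis .
  qed
  fix \<gamma> \<delta> assume g: "\<gamma> \<in> DD p q" and d: "\<delta> \<in> DD p q" and eq: "dinv \<gamma> = dinv \<delta>"
  show "\<gamma> = \<delta>"
    using assms(2) g
  proof (cases rule: DD_cases)
    case (low i m)
    note g' = this
    show ?thesis using assms(2) d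
    proof (cases rule: DD_cases)
      case (low i' m')
      then show ?thesis using g' nu_gam_small(1)[of p i q m] nu_gam_small(1)[of p i' q m']
          tri_block_unique[of i m i' m'] eq assms(1) by auto
    next
      case (high l m')
      then show ?thesis using low_high[OF g' high] eq by simp
    qed
  next
    case (high l m)
    note g' = this
    show ?thesis using assms(2) d
    proof (cases rule: DD_cases)
      case (low i' m')
      then show ?thesis using low_high[OF low g'] eq by simp
    next
      case (high l' m')
      then show ?thesis using g' nu_gam_high(1)[of p q l m] nu_gam_high(1)[of p q l' m']
          tri_block_unique[of l m l' m'] eq assms by auto
    qed
  qed
qed

section \<open>Duality of the values of \<open>dinv\<close>\<close>

text \<open>Values of \<open>dinv\<close> on \<open>DD p q \<inter> DP n\<close> coming from \<open>gam p q l\<close> with \<open>l \<le> q - 2\<close>, and from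
  \<open>gam p q (l - 1)\<close> with \<open>l \<ge> q\<close>. The upper end of the block of values belonging to \<open>l\<close> is dropped
  from the conditions: this leaves the union over \<open>l\<close> unchanged, and makes them dual to each other.\<close>

definition low_val :: "nat \<Rightarrow> nat \<Rightarrow> nat \<Rightarrow> nat \<Rightarrow> int \<Rightarrow> bool" where
  "low_val p q n l k \<longleftrightarrow> int (tri l) + 1 \<le> k \<and>
     k \<le> int l * int n - int (tri l) + 1 - (int q - 1) * int p"

definition high_val :: "nat \<Rightarrow> nat \<Rightarrow> nat \<Rightarrow> nat \<Rightarrow> int \<Rightarrow> bool" where
  "high_val p q n l k \<longleftrightarrow> int (tri l) + 1 - int q \<le> k \<and>
     k \<le> int l * int n - int (tri l) + 1 - int q * int p"

lemma int_double_tri: "2 * int (tri l) = int l * (int l + 1)"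
proof -
  have "int (2 * tri l) = int (l * (l + 1))" by (simp only: double_tri)
  then show ?thesis by (simp add: algebra_simps)
qed

lemma mult_gap: "int l * (int n - int l - 1) = int l * int n - 2 * int (tri l)"
  unfolding int_double_tri by (simp add: algebra_simps)

text \<open>Comparing the two bounds on \<open>k\<close> gives the first claim. Its left side is
  positive, which makes \<open>n - l - 1\<close> positive, so the reflected index is at least
  1.\<close>

lemma low_val_gap:
  assumes "low_val p q n l k" "2 \<le> p" "2 \<le> q"
  shows "(int q - 1) * int p \<le> int l * (int n - int l - 1)" "l + 1 < n"
proof -
  show *: "(int q - 1) * int p \<le> int l * (int n - int l - 1)"
    using assms(1) unfolding mult_gap low_val_def by linarith
  have "0 < (int q - 1) * int p" using assms(2,3) by (intro mult_pos_pos) auto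
  with * have "0 < int l * (int n - int l - 1)" by linarith
  then show "l + 1 < n" by (simp add: zero_less_mult_iff)
qed

lemma high_val_gap:
  assumes "high_val p q n l k" "2 \<le> p" "2 \<le> q"
  shows "l + 1 < n"
proof -
  have "int q * (int p - 1) \<le> int l * (int n - int l - 1)"
    using assms(1) unfolding mult_gap high_val_def by (simp add: algebra_simps)
  moreover have "0 < int q * (int p - 1)" using assms(2,3) by (intro mult_pos_pos) auto
  ultimately have "0 < int l * (int n - int l - 1)" by linarith
  then show ?thesis by (simp add: zero_less_mult_iff)
qed

text \<open>From \<open>l\<close> to \<open>Suc l\<close> the upper end of the interval rises by
  \<open>n - l - 1 > 0\<close>, so a value beyond the block of \<open>l\<close> falls into the next
  interval. This makes it harmless to drop the upper ends of the blocks.\<close>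

lemma low_val_Suc:
  assumes "low_val p q n l k" "2 \<le> p" "2 \<le> q" "int (tri (Suc l)) < k"
  shows "low_val p q n (Suc l) k"
  using assms low_val_gap[OF assms(1-3)] by (auto simp: low_val_def tri_Suc algebra_simps)

lemma high_val_Suc:
  assumes "high_val p q n l k" "2 \<le> p" "2 \<le> q" "int (tri (Suc l)) < k + int q"
  shows "high_val p q n (Suc l) k"
  using assms high_val_gap[OF assms(1-3)] by (auto simp: high_val_def tri_Suc algebra_simps)

text \<open>Both intervals start at \<open>tri (q - 1) + 1\<close>. The upper end of the high one is
  larger by \<open>n - p - q\<close>, which is nonnegative once the low one is nonempty.\<close>

lemma low_val_imp_high_val:
  assumes "low_val p q n (q - 1) k" "2 \<le> p" "2 \<le> q"
  shows "high_val p q n q k"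
proof -
  obtain l where l: "q = Suc l" using assms(3) by (cases q) auto
  have "int l * int p \<le> int l * (int n - int l - 1)"
    using low_val_gap(1)[OF assms] l by simp
  then have "int p \<le> int n - int l - 1" using assms(3) l by simp
  then show ?thesis using assms(1) unfolding l by (simp add: low_val_def high_val_def tri_Suc algebra_simps)
qed

text \<open>The low interval of \<open>s\<close> begins no earlier than the high one of
  \<open>s\<close> and, by \<open>p + s < n\<close>, ends no later than the high one of
  \<open>Suc s\<close>. Those two high intervals leave no integer between them, which is the
  estimate \<open>q * (p - 1) \<le> s * (n - s - 2)\<close>.\<close>

lemma low_val_imp_high_val_mid:
  assumes "low_val p q n s k" "2 \<le> p" "2 \<le> q" "q \<le> s" "p + s < n"
  shows "high_val p q n s k \<or> high_val p q n (Suc s) k"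
proof (cases "k \<le> int s * int n - int (tri s) + 1 - int q * int p")
  case True
  then show ?thesis using assms(1) by (auto simp: high_val_def low_val_def)
next
  case False
  have "int q * (int p - 1) \<le> int s * (int n - int s - 2)"
    using assms by (intro mult_mono) auto
  also have "\<dots> = int s * (int n - int s - 1) - int s" by (simp add: algebra_simps)
  finally have "int (tri (Suc s)) + 1 - int q \<le> k"
    using False unfolding mult_gap by (simp add: tri_Suc algebra_simps)
  moreover have "k \<le> int (Suc s) * int n - int (tri (Suc s)) + 1 - int q * int p"
    using assms(1,5) by (simp add: low_val_def tri_Suc algebra_simps)
  ultimately show ?thesis by (simp add: high_val_def)
qed

lemma tri_add: "tri (s + l) = tri s + tri l + s * l"
  by (induction l) (auto simp: tri_Suc, simp add: tri_def)

text \<open>Here \<open>n choose 2 = tri s + tri l + s * l\<close> and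
  \<open>l * n - tri l = s * l + tri l\<close>, and likewise for \<open>s\<close>. After
  substitution the reflection sends the lower bound of each interval to the upper bound of the
  other.\<close>

lemma low_val_dual:
  assumes "n = s + l + 1" "k + k' = int (n choose 2) - int (p * q) + 2"
  shows "low_val p q n l k \<longleftrightarrow> high_val q p n s k'"
proof -
  have c: "int (n choose 2) = int (tri s) + int (tri l) + int s * int l"
    using tri_add[of s l] assms(1) by (simp add: tri_def)
  have s: "int s * int n = int s * int l + 2 * int (tri s)"
    and l: "int l * int n = int s * int l + 2 * int (tri l)"
    unfolding int_double_tri using assms(1) by (auto simp: algebra_simps)
  have k': "k' = int (tri s) + int (tri l) + int s * int l - int p * int q + 2 - k"
    using assms(2) unfolding c by simp
  have "(int q - 1) * int p = int p * int q - int p" by (simp add: algebra_simps)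
  then show ?thesis unfolding low_val_def high_val_def s l k' by auto
qed

definition has_val :: "nat \<Rightarrow> nat \<Rightarrow> nat \<Rightarrow> int \<Rightarrow> bool" where
  "has_val p q n k \<longleftrightarrow>
    (\<exists>l. 1 \<le> l \<and> l + 2 \<le> q \<and> low_val p q n l k) \<or> (\<exists>l. q \<le> l \<and> high_val p q n l k)"

lemma has_val_dual:
  assumes "2 \<le> p" "2 \<le> q" "has_val p q n k" "k + k' = int (n choose 2) - int (p * q) + 2"
  shows "has_val q p n k'"
proof -
  consider (low) l where "1 \<le> l" "l + 2 \<le> q" "low_val p q n l k"
    | (high) l where "q \<le> l" "high_val p q n l k"
    using assms(3) unfolding has_val_def by blast
  then show ?thesis
  proof cases
    case l: low
    define s where "s = n - l - 1"
    have n: "n = s + l + 1" using low_val_gap(2)[OF l(3) assms(1,2)] by (simp add: s_def)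
    \<comment> \<open>Nonemptiness of the low interval puts the reflected index \<open>s\<close>
      into the range \<open>p \<le> s\<close> of the high chains.\<close>
    have "int l * int p \<le> (int q - 1) * int p" using l by (intro mult_right_mono) auto
    also have "\<dots> \<le> int l * int s" using low_val_gap(1)[OF l(3) assms(1,2)] n by simp
    finally have "p \<le> s" using l by simp
    then show "has_val q p n k'"
      using low_val_dual[OF n assms(4)] l(3) by (auto simp: has_val_def)
  next
    case l: high
    define s where "s = n - l - 1"
    have ln: "l + 1 < n" using high_val_gap[OF l(2) assms(1,2)] .
    then have n: "n = l + s + 1" and s: "1 \<le> s" by (auto simp: s_def)
    have d: "k' + k = int (n choose 2) - int (q * p) + 2" using assms(4) by (simp add: mult.commute)
    have low: "low_val q p n s k'" using low_val_dual[OF n d] l(2) by simp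
    \<comment> \<open>The reflected index may exceed \<open>p - 2\<close>, where there is no low
      chain; such a low interval is covered by high ones.\<close>
    consider "s + 2 \<le> p" | "s = p - 1" | "p \<le> s" by linarith
    then show "has_val q p n k'"
    proof cases
      case 1
      then show ?thesis using s low by (auto simp: has_val_def)
    next
      case 2
      then show ?thesis using low_val_imp_high_val[of q p n k'] low assms(1,2) by (auto simp: has_val_def)
    next
      case 3
      then have "high_val q p n s k' \<or> high_val q p n (Suc s) k'"
        using low_val_imp_high_val_mid[OF low assms(2,1) 3] l n by simp
      then show ?thesis using 3 le_SucI[OF 3] unfolding has_val_def by blast
    qed
  qed
qed

lemma has_val_dinv:
  assumes "2 \<le> p" "2 \<le> q" "\<gamma> \<in> DD p q \<inter> DP n"
  shows "has_val p q n (int (dinv \<gamma>))"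
proof -
  have D: "\<gamma> \<in> DD p q" and n: "\<gamma> \<in> DP n" using assms(3) by auto
  show ?thesis using assms(2) D
  proof (cases rule: DD_cases)
    case (low i m)
    have "int ((q - 1) * p) = (int q - 1) * int p" using assms(2) by (simp add: of_nat_diff)
    then have "low_val p q n i (int (dinv \<gamma>))"
      using nu_gam_small[OF assms(1) low(1-3)] n low(4) unfolding mult_gap by (auto simp: low_val_def)
    then show ?thesis using low by (auto simp: has_val_def)
  next
    case (high l m)
    have "int (q * (p - 1)) = int q * int p - int q" using assms(1) by (simp add: of_nat_diff algebra_simps)
    moreover have "int (dinv \<gamma>) + int q = int (tri l) + 1 + int m"
      using nu_gam_high(1)[OF assms(1,2) high(1,2)] high(3) by simp
    ultimately have "high_val p q n l (int (dinv \<gamma>))"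
      using nu_gam_high(3)[OF assms(1,2) high(1,2), of n] n high(3) unfolding mult_gap
      by (auto simp: high_val_def)
    then show ?thesis using high by (auto simp: has_val_def)
  qed
qed

text \<open>Raise \<open>l\<close> as long as \<open>k\<close> lies beyond its block;
  \<open>high_val_Suc\<close> preserves the condition, and the measure decreases because
  \<open>l < k + q\<close> at that point. Once \<open>k\<close> is in the block, its offset is the
  number \<open>m\<close> of applications of \<open>nu\<close>.\<close>

lemma high_val_realized:
  assumes "2 \<le> p" "2 \<le> q" "q \<le> l" "high_val p q n l k"
  shows "\<exists>\<gamma> \<in> DD p q \<inter> DP n. int (dinv \<gamma>) = k"
  using assms(3,4)
proof (induction "nat (k + int q) - l" arbitrary: l rule: less_induct)
  case less
  show ?case
  proof (cases "int (tri (Suc l)) < k + int q")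
    case True
    have "l < tri (Suc l)" by (simp add: tri_Suc)
    then have "nat (k + int q) - Suc l < nat (k + int q) - l" using True by linarith
    then show ?thesis using less high_val_Suc[OF less.prems(2) assms(1,2) True] by simp
  next
    case False
    define m where "m = nat (k + int q - int (tri l) - 1)"
    have m: "int m = k + int q - int (tri l) - 1" "m \<le> l"
      using less.prems(2) False by (auto simp: m_def high_val_def tri_Suc)
    let ?\<gamma> = "(nu ^^ m) (gam p q (l - 1))"
    have "int (q * (p - 1)) = int q * int p - int q" using assms(1) by (simp add: of_nat_diff algebra_simps)
    then have "?\<gamma> \<in> DP n"
      using nu_gam_high(3)[OF assms(1,2) less.prems(1) m(2), of n] m(1) less.prems(2)
      unfolding mult_gap high_val_def by auto
    moreover have "int (dinv ?\<gamma>) = k"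
      using nu_gam_high(1)[OF assms(1,2) less.prems(1) m(2)] m(1) by linarith
    ultimately show ?thesis using high_in_DD[OF assms(2) less.prems(1) m(2), of p] by blast
  qed
qed

text \<open>The same ascent as for high values, except that on reaching index \<open>q - 1\<close>
  it passes to the high interval of \<open>q\<close>.\<close>

lemma low_val_realized:
  assumes "2 \<le> p" "2 \<le> q" "1 \<le> l" "l + 2 \<le> q" "low_val p q n l k"
  shows "\<exists>\<gamma> \<in> DD p q \<inter> DP n. int (dinv \<gamma>) = k"
  using assms(3,4,5)
proof (induction "q - l" arbitrary: l rule: less_induct)
  case less
  show ?case
  proof (cases "int (tri (Suc l)) < k")
    case True
    note S = low_val_Suc[OF less.prems(3) assms(1,2) True]
    show ?thesis
    proof (cases "Suc l + 2 \<le> q")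
      case True
      then show ?thesis using less.hyps[of "Suc l"] S by simp
    next
      case False
      then have "Suc l = q - 1" using less.prems by simp
      then have "high_val p q n q k" using low_val_imp_high_val[OF _ assms(1,2)] S by metis
      then show ?thesis using high_val_realized[OF assms(1,2) order_refl] by blast
    qed
  next
    case False
    define m where "m = nat (k - int (tri l) - 1)"
    have m: "int m = k - int (tri l) - 1" "m \<le> l"
      using less.prems(3) False by (auto simp: m_def low_val_def tri_Suc)
    let ?\<gamma> = "(nu ^^ m) (gam p q l)"
    have "int ((q - 1) * p) = (int q - 1) * int p" using assms(2) by (simp add: of_nat_diff)
    then have "?\<gamma> \<in> DP n"
      using nu_gam_small(3)[OF assms(1) less.prems(1,2) m(2), of n] m(1) less.prems(3)
      unfolding mult_gap low_val_def by auto
    moreover have "int (dinv ?\<gamma>) = k"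
      using nu_gam_small(1)[OF assms(1) less.prems(1,2) m(2)] m(1) by linarith
    ultimately show ?thesis using low_in_DD[OF less.prems(1,2) m(2), of p] by blast
  qed
qed

section \<open>Matching values and the unique bijection\<close>

lemma opposite_exists:
  assumes "2 \<le> p" "2 \<le> q" "\<gamma> \<in> DD p q \<inter> DP n"
  shows "\<exists>\<delta> \<in> DD q p \<inter> DP n. int (dinv \<delta>) = area n \<gamma>"
proof -
  have "psize \<gamma> + 2 = dinv \<gamma> + p * q"
    using psize_DD[OF assms(1,2), of \<gamma>] assms(3) by simp
  then have "int (psize \<gamma>) + 2 = int (dinv \<gamma>) + int (p * q)" by linarith
  then have "int (dinv \<gamma>) + area n \<gamma> = int (n choose 2) - int (p * q) + 2"
    by (simp add: area_def)
  from has_val_dual[OF assms(1,2) has_val_dinv[OF assms] this]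
  show ?thesis unfolding has_val_def
    using low_val_realized[OF assms(2,1)] high_val_realized[OF assms(2,1)] by blast
qed

text \<open>As size minus \<open>dinv\<close> is the constant \<open>d\<close>, the relation
  \<open>dinv \<gamma> = area n \<delta>\<close> reads
  \<open>dinv \<gamma> + dinv \<delta> = (n choose 2) - d\<close> and is symmetric. So each of the
  two required equations gives the other. Injectivity of \<open>dinv\<close> on \<open>B\<close>
  makes the map injective, and on \<open>C\<close> it makes the map surjective and unique.\<close>

lemma n_oppositeI:
  assumes "B \<subseteq> DP n" "C \<subseteq> DP n" "inj_on dinv B" "inj_on dinv C"
    and size: "\<And>\<gamma>. \<gamma> \<in> B \<union> C \<Longrightarrow> int (psize \<gamma>) = int (dinv \<gamma>) + d"
    and BC: "\<And>\<gamma>. \<gamma> \<in> B \<Longrightarrow> \<exists>\<delta> \<in> C. int (dinv \<delta>) = area n \<gamma>"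
    and CB: "\<And>\<gamma>. \<gamma> \<in> C \<Longrightarrow> \<exists>\<delta> \<in> B. int (dinv \<delta>) = area n \<gamma>"
  shows "n_opposite n B C"
proof -
  have swap: "int (dinv \<gamma>) = area n \<delta> \<longleftrightarrow> int (dinv \<delta>) = area n \<gamma>" if "\<gamma> \<in> B \<union> C" "\<delta> \<in> B \<union> C" for \<gamma> \<delta>
    using size[OF that(1)] size[OF that(2)] by (auto simp: area_def)
  obtain f where f: "\<And>\<gamma>. \<gamma> \<in> B \<Longrightarrow> f \<gamma> \<in> C" "\<And>\<gamma>. \<gamma> \<in> B \<Longrightarrow> int (dinv (f \<gamma>)) = area n \<gamma>"
    using BC by metis
  define g where "g = restrict f B"
  have g: "g \<gamma> \<in> C" "int (dinv (g \<gamma>)) = area n \<gamma>" "int (dinv \<gamma>) = area n (g \<gamma>)" if "\<gamma> \<in> B" for \<gamma>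
    using f that swap[of "f \<gamma>" \<gamma>] by (auto simp: g_def)
  have bij: "bij_betw g B C"
  proof (rule bij_betw_imageI)
    show "inj_on g B"
    proof (rule inj_onI)
      fix x y assume "x \<in> B" "y \<in> B" "g x = g y"
      then have "dinv x = dinv y" using g(3)[of x] g(3)[of y] by simp
      then show "x = y" using \<open>x \<in> B\<close> \<open>y \<in> B\<close> assms(3) by (auto dest: inj_onD)
    qed
    show "g ` B = C"
    proof
      show "C \<subseteq> g ` B"
      proof
        fix \<gamma> assume c: "\<gamma> \<in> C"
        then obtain \<delta> where d: "\<delta> \<in> B" "int (dinv \<delta>) = area n \<gamma>" using CB by blast
        then have "dinv \<gamma> = dinv (g \<delta>)" using swap[of \<delta> \<gamma>] g(2)[of \<delta>] c by simp
        then have "\<gamma> = g \<delta>" using assms(4) c g(1)[OF d(1)] by (auto dest: inj_onD)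
        then show "\<gamma> \<in> g ` B" using d(1) by blast
      qed
    qed (use g(1) in auto)
  qed
  have uniq: "h = g" if "h \<in> extensional B" "bij_betw h B C" "\<forall>\<gamma>\<in>B. area n \<gamma> = int (dinv (h \<gamma>))" for h
  proof (rule extensionalityI[OF that(1)])
    show "g \<in> extensional B" by (simp add: g_def)
    fix \<gamma> assume b: "\<gamma> \<in> B"
    then have "dinv (h \<gamma>) = dinv (g \<gamma>)" "h \<gamma> \<in> C" using g(2) that bij_betwE[OF that(2)] by auto
    then show "h \<gamma> = g \<gamma>" using assms(4) g(1)[OF b] by (auto dest: inj_onD)
  qed
  have "\<exists>!g. g \<in> extensional B \<and> bij_betw g B C \<and>
      (\<forall>\<gamma>\<in>B. area n \<gamma> = int (dinv (g \<gamma>)) \<and> int (dinv \<gamma>) = area n (g \<gamma>))"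
  proof (intro ex1I[of _ g] conjI ballI)
    show "g \<in> extensional B" by (simp add: g_def)
    show "area n \<gamma> = int (dinv (g \<gamma>))" "int (dinv \<gamma>) = area n (g \<gamma>)" if "\<gamma> \<in> B" for \<gamma>
      using g(2,3)[OF that] by simp_all
  qed (use bij uniq in auto)
  then show ?thesis unfolding n_opposite_def using assms(1,2) by simp
qed

theorem theorem3p5:
  fixes a b n :: nat
  assumes "a \<ge> 2" and "b \<ge> 2"
  shows "n_opposite n (DD a b \<inter> DP n) (DD b a \<inter> DP n)"
proof (rule n_oppositeI[where d = "int (a * b) - 2"])
  show "int (psize \<gamma>) = int (dinv \<gamma>) + (int (a * b) - 2)" if "\<gamma> \<in> DD a b \<inter> DP n \<union> DD b a \<inter> DP n" for \<gamma>
  proof -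
    have "psize \<gamma> + 2 = dinv \<gamma> + a * b"
      using that psize_DD[OF assms, of \<gamma>] psize_DD[OF assms(2,1), of \<gamma>] by (auto simp: mult.commute)
    then show ?thesis by linarith
  qed
  show "inj_on dinv (DD a b \<inter> DP n)" "inj_on dinv (DD b a \<inter> DP n)"
    using inj_on_dinv_DD[OF assms] inj_on_dinv_DD[OF assms(2,1)] by (auto intro: inj_on_subset)
  show "\<exists>\<delta> \<in> DD b a \<inter> DP n. int (dinv \<delta>) = area n \<gamma>" if "\<gamma> \<in> DD a b \<inter> DP n" for \<gamma>
    using opposite_exists[OF assms that] .
  show "\<exists>\<delta> \<in> DD a b \<inter> DP n. int (dinv \<delta>) = area n \<gamma>" if "\<gamma> \<in> DD b a \<inter> DP n" for \<gamma>
    using opposite_exists[OF assms(2,1) that] .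
qed auto

end
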